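(* Let $n\geq 2$, let $w\in F_n$ be a non-empty cyclically reduced word and assume that the cyclic presentation $P_n(w)$ is redundant. If either $n\geq 3$, or $n=2$ and $w$ is a proper power, then the group $G_n(w)$ is large. In particular, if $P_n(w)$ is a redundant $(m,k,\nu)$-special cyclic presentation (for some $m\geq 2$, $k\geq 3$, $\nu\geq 1$) then $G_n(w)$ is large.
   Context: $F_n$ is the free group with basis $x_0,\ldots,x_{n-1}$; subscripts are taken modulo $n$; $\theta(x_i)=x_{i+1}$. $P_n(w)=\langle x_0,\ldots,x_{n-1}\mid w,\theta(w),\ldots,\theta^{n-1}(w)\rangle$ and $G_n(w)$ is the group it defines. A presentation with cyclically reduced relators is redundant if some relator $r$ is freely trivial or there is another relator $s$ such that $r$ is a cyclic permutation of $s$ or of $s^{-1}$. A group is large if it has a finite index subgroup that has a non-abelian free homomorphic image. Star graph: for a presentation $P=\langle X\mid R\rangle$ with cyclically reduced relators, let $\tilde R$ be the set of all cyclic permutations of elements of $R\cup R^{-1}$. The star graph of $P$ is the undirected graph (multiple edges allowed) with vertex set $X\cup X^{-1}$ and an edge joining $x$ and $y$ ($x,y\in X\cup X^{-1}$) for each distinct word in $\tilde R$ of the form $xy^{-1}z$, where the edges arising from the inverse pair $xy^{-1}z$ and $yx^{-1}z^{-1}$ are identified. $(m,k,\nu)$-special: let $m\geq 2$, $k\geq 3$, $\nu\geq 1$. A finite presentation is $(m,k,\nu)$-special if (a) its star graph has $\nu$ connected components, which are pairwise isomorphic, each being a connected bipartite graph of diameter $m$ and girth $2m$ in which each vertex has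 degree at least $3$; (b) each relator has length $k$; (c) if $m=2$ then $k\geq 4$. (Girth is the minimal length of a reduced closed path; a pair of parallel edges gives girth at most $2$.) *)

theory Defs
  imports
    "HOL-Algebra.Generated_Groups"
    "HOL-Library.Extended_Nat"
begin

section \<open>Words and free groups\<close>

text \<open>The letter \<open>(x, True)\<close> is the generator \<open>x\<close>, and \<open>(x, False)\<close> is its inverse.\<close>

type_synonym 'a letter = "'a \<times> bool"
type_synonym 'a word = "'a letter list"

definition linv :: "'a letter \<Rightarrow> 'a letter" where
  "linv a = (fst a, \<not> snd a)"

definition winv :: "'a word \<Rightarrow> 'a word" where
  "winv w = rev (map linv w)"

definition reduced :: "'a word \<Rightarrow> bool" where
  "reduced w \<longleftrightarrow> successively (\<lambda>a b. b \<noteq> linv a) w"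

definition cyclically_reduced :: "'a word \<Rightarrow> bool" where
  "cyclically_reduced w \<longleftrightarrow> reduced w \<and> (w \<noteq> [] \<longrightarrow> last w \<noteq> linv (hd w))"

definition cyclic_permutation :: "'a word \<Rightarrow> 'a word \<Rightarrow> bool" where
  "cyclic_permutation u v \<longleftrightarrow> (\<exists>j. u = rotate j v)"

fun cons_red :: "'a letter \<Rightarrow> 'a word \<Rightarrow> 'a word" where
  "cons_red a [] = [a]"
| "cons_red a (b # w) = (if b = linv a then w else a # b # w)"

definition free_reduce :: "'a word \<Rightarrow> 'a word" where
  "free_reduce w = foldr cons_red w []"

text \<open>The free group with basis \<open>X\<close>, realised on the reduced words in \<open>X\<close>.\<close>

definition free_group :: "'a set \<Rightarrow> 'a word monoid" where
  "free_group X =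
     \<lparr>carrier = {w. reduced w \<and> fst ` set w \<subseteq> X},
      mult = (\<lambda>u v. free_reduce (u @ v)), one = []\<rparr>"

lemma linv_linv [simp]: "linv (linv a) = a"
  by (simp add: linv_def)

lemma fst_linv [simp]: "fst (linv a) = fst a"
  by (simp add: linv_def)

lemma linv_eq_iff: "linv a = b \<longleftrightarrow> a = linv b"
  by auto

lemma reduced_Nil [simp]: "reduced []"
  by (simp add: reduced_def)

lemma reduced_single [simp]: "reduced [a]"
  by (simp add: reduced_def)

lemma reduced_Cons_Cons [simp]:
  "reduced (a # b # w) \<longleftrightarrow> b \<noteq> linv a \<and> reduced (b # w)"
  by (simp add: reduced_def)

lemma reduced_ConsD: "reduced (a # w) \<Longrightarrow> reduced w"
  by (cases w) auto

lemma reduced_cons_red: "reduced w \<Longrightarrow> reduced (cons_red a w)"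
  by (cases w) (auto dest: reduced_ConsD)

lemma reduced_foldr: "reduced w \<Longrightarrow> reduced (foldr cons_red u w)"
  by (induction u) (auto intro: reduced_cons_red)

lemma reduced_free_reduce: "reduced (free_reduce w)"
  by (simp add: free_reduce_def reduced_foldr)

lemma cons_red_cancel: "reduced w \<Longrightarrow> cons_red a (cons_red (linv a) w) = w"
proof (cases w)
  case (Cons b v)
  assume "reduced w"
  with Cons show ?thesis by (cases v) auto
qed simp

lemma foldr_cons_red:
  "reduced w \<Longrightarrow> foldr cons_red (cons_red a u) w = cons_red a (foldr cons_red u w)"
proof (cases u)
  case (Cons b v)
  assume w: "reduced w"
  show ?thesis
  proof (cases "b = linv a")
    case True
    then show ?thesis using Cons w by (simp add: cons_red_cancel reduced_foldr)
  qed (use Cons in simp)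
qed simp

lemma foldr_free_reduce:
  "reduced w \<Longrightarrow> foldr cons_red (free_reduce u) w = foldr cons_red u w"
  by (induction u) (auto simp: free_reduce_def foldr_cons_red)

lemma free_reduce_reduced: "reduced w \<Longrightarrow> free_reduce w = w"
proof (induction w)
  case (Cons a w)
  then have "free_reduce w = w" by (blast dest: reduced_ConsD)
  then show ?case using Cons.prems by (cases w) (auto simp: free_reduce_def)
qed (simp add: free_reduce_def)

lemma free_reduce_append: "free_reduce (u @ v) = foldr cons_red u (free_reduce v)"
  by (simp add: free_reduce_def)

lemma set_cons_red: "set (cons_red a w) \<subseteq> insert a (set w)"
  by (cases w) auto

lemma set_free_reduce: "set (free_reduce w) \<subseteq> set w"
proof (induction w)
  case (Cons a w)
  then show ?case using set_cons_red[of a "free_reduce w"] by (auto simp: free_reduce_def)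
qed (simp add: free_reduce_def)

lemma foldr_winv: "reduced w \<Longrightarrow> foldr cons_red (winv u) (foldr cons_red u w) = w"
proof (induction u)
  case (Cons a u)
  then show ?case
    using cons_red_cancel[of "foldr cons_red u w" "linv a"]
    by (simp add: winv_def reduced_foldr)
qed (simp add: winv_def)

lemma reduced_winv: "reduced w \<Longrightarrow> reduced (winv w)"
  unfolding reduced_def winv_def successively_rev successively_map
  by (erule successively_mono) (auto simp: linv_eq_iff)

lemma group_free_group: "group (free_group X)"
proof (rule groupI)
  fix u v assume "u \<in> carrier (free_group X)" "v \<in> carrier (free_group X)"
  then have "fst ` set (u @ v) \<subseteq> X" by (simp add: free_group_def image_Un)
  then have "fst ` set (free_reduce (u @ v)) \<subseteq> X"
    by (rule order_trans[OF image_mono[OF set_free_reduce]])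
  then show "u \<otimes>\<^bsub>free_group X\<^esub> v \<in> carrier (free_group X)"
    by (simp add: free_group_def reduced_free_reduce)
next
  fix u v w assume w: "w \<in> carrier (free_group X)"
  have w': "reduced w" using w by (simp add: free_group_def)
  have "free_reduce (free_reduce (u @ v) @ w) = foldr cons_red (free_reduce (u @ v)) w"
    using w' by (simp only: free_reduce_append free_reduce_reduced)
  also have "\<dots> = foldr cons_red u (foldr cons_red v w)"
    using w' by (simp only: foldr_free_reduce foldr_append o_def)
  also have "\<dots> = foldr cons_red u (free_reduce (v @ w))"
    using w' by (simp only: free_reduce_append free_reduce_reduced)
  also have "\<dots> = free_reduce (u @ free_reduce (v @ w))"
    by (simp only: free_reduce_append[of u] free_reduce_reduced reduced_free_reduce)
  finally show "u \<otimes>\<^bsub>free_group X\<^esub> v \<otimes>\<^bsub>free_group X\<^esub> w =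
      u \<otimes>\<^bsub>free_group X\<^esub> (v \<otimes>\<^bsub>free_group X\<^esub> w)"
    by (simp add: free_group_def)
next
  fix u assume u: "u \<in> carrier (free_group X)"
  then have "winv u \<in> carrier (free_group X)"
    by (simp add: free_group_def reduced_winv) (simp add: winv_def image_image)
  moreover have "winv u \<otimes>\<^bsub>free_group X\<^esub> u = \<one>\<^bsub>free_group X\<^esub>"
    using foldr_winv[of "[]" u] by (simp add: free_group_def free_reduce_def)
  ultimately show "\<exists>v\<in>carrier (free_group X). v \<otimes>\<^bsub>free_group X\<^esub> u = \<one>\<^bsub>free_group X\<^esub>"
    by blast
qed (simp_all add: free_group_def free_reduce_reduced)


section \<open>Group-theoretic notions\<close>

definition normal_closure :: "('a, 'b) monoid_scheme \<Rightarrow> 'a set \<Rightarrow> 'a set" where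
  "normal_closure G R =
     generate G {g \<otimes>\<^bsub>G\<^esub> r \<otimes>\<^bsub>G\<^esub> inv\<^bsub>G\<^esub> g | g r. g \<in> carrier G \<and> r \<in> R}"

lemma (in group) normal_normal_closure:
  assumes "R \<subseteq> carrier G"
  shows "normal_closure G R \<lhd> G"
  unfolding normal_closure_def
proof (rule normal_generateI)
  show "{g \<otimes> r \<otimes> inv g | g r. g \<in> carrier G \<and> r \<in> R} \<subseteq> carrier G"
    using assms by auto
next
  fix h k
  assume "h \<in> {g \<otimes> r \<otimes> inv g | g r. g \<in> carrier G \<and> r \<in> R}" and k: "k \<in> carrier G"
  then obtain g r where h: "h = g \<otimes> r \<otimes> inv g" "g \<in> carrier G" "r \<in> R" by blast
  then have "k \<otimes> h \<otimes> inv k = (k \<otimes> g) \<otimes> r \<otimes> inv (k \<otimes> g)"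
    using assms k by (auto simp: m_assoc inv_mult_group subset_iff)
  then show "k \<otimes> h \<otimes> inv k \<in> {g \<otimes> r \<otimes> inv g | g r. g \<in> carrier G \<and> r \<in> R}"
    using h k by blast
qed

definition proper_power :: "('a, 'b) monoid_scheme \<Rightarrow> 'a \<Rightarrow> bool" where
  "proper_power G g \<longleftrightarrow> (\<exists>u\<in>carrier G. \<exists>p::nat. 2 \<le> p \<and> g = u [^]\<^bsub>G\<^esub> p)"

text \<open>The basis \<open>S\<close> may be taken in the element type of \<open>G\<close>: choosing a preimage in \<open>H\<close> of each
  element of a basis of a free image of \<open>H\<close> identifies that basis with a subset of \<open>H\<close>.\<close>

definition large :: "('a, 'b) monoid_scheme \<Rightarrow> bool" where
  "large G \<longleftrightarrow>
     (\<exists>H. subgroup H G \<and> finite (rcosets\<^bsub>G\<^esub> H) \<and>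
       (\<exists>(S::'a set) f. f \<in> epi (G\<lparr>carrier := H\<rparr>) (free_group S) \<and>
          \<not> comm_group (free_group S)))"


section \<open>Presentations\<close>

text \<open>The relators form a list, so that equal relators at different positions count as
  different relators in \<open>redundant\<close>.\<close>

record 'a presentation =
  gens :: "'a set"
  rels :: "'a word list"

definition presented_group :: "'a presentation \<Rightarrow> 'a word set monoid" where
  "presented_group P =
     free_group (gens P) Mod normal_closure (free_group (gens P)) (set (rels P))"

definition redundant :: "'a presentation \<Rightarrow> bool" where
  "redundant P \<longleftrightarrow>
     (\<exists>i<length (rels P). free_reduce (rels P ! i) = [] \<or>
        (\<exists>j<length (rels P). j \<noteq> i \<and>
           (cyclic_permutation (rels P ! i) (rels P ! j) \<or>
            cyclic_permutation (rels P ! i) (winv (rels P ! j)))))"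

definition shift :: "nat \<Rightarrow> nat word \<Rightarrow> nat word" where
  "shift n w = map (\<lambda>(i, s). ((i + 1) mod n, s)) w"

definition cyclic_presentation :: "nat \<Rightarrow> nat word \<Rightarrow> nat presentation" where
  "cyclic_presentation n w =
     \<lparr>gens = {..<n}, rels = map (\<lambda>i. (shift n ^^ i) w) [0..<n]\<rparr>"

lemma shift_closed:
  assumes "w \<in> carrier (free_group {..<n})"
  shows "shift n w \<in> carrier (free_group {..<n})"
proof -
  have w: "reduced w" "\<forall>a\<in>set w. fst a < n" using assms by (auto simp: free_group_def)
  have inj: "i = j" if "Suc i mod n = Suc j mod n" "i < n" "j < n" for i j
    using that by (auto simp: mod_Suc split: if_splits)
  have "reduced (shift n w)"
    unfolding reduced_def shift_def successively_map
  proof (rule successively_mono[OF w(1)[unfolded reduced_def]])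
    fix a b assume ab: "a \<in> set w" "b \<in> set w" "b \<noteq> linv a"
    then have "fst a < n" "fst b < n" using w(2) by blast+
    then show "(\<lambda>(i, s). ((i + 1) mod n, s)) b \<noteq> linv ((\<lambda>(i, s). ((i + 1) mod n, s)) a)"
      using ab(3) inj[of "fst a" "fst b"]
      by (cases a; cases b) (auto simp: linv_def)
  qed
  moreover have "fst ` set (shift n w) \<subseteq> {..<n}"
    using w(2) by (cases "n = 0"; cases w) (auto simp: shift_def)
  ultimately show ?thesis by (simp add: free_group_def)
qed

definition cyclically_presented_group :: "nat \<Rightarrow> nat word \<Rightarrow> nat word set monoid" where
  "cyclically_presented_group n w = presented_group (cyclic_presentation n w)"

lemma group_cyclically_presented_group:
  assumes "w \<in> carrier (free_group {..<n})"
  shows "group (cyclically_presented_group n w)"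
proof -
  have "(shift n ^^ i) w \<in> carrier (free_group {..<n})" for i
    by (induction i) (use assms shift_closed in auto)
  then have "normal_closure (free_group {..<n}) (set (rels (cyclic_presentation n w)))
      \<lhd> free_group {..<n}"
    by (intro group.normal_normal_closure group_free_group) (auto simp: cyclic_presentation_def)
  then show ?thesis
    unfolding cyclically_presented_group_def presented_group_def
    by (simp add: cyclic_presentation_def normal.factorgroup_is_group)
qed


section \<open>Undirected multigraphs\<close>

text \<open>\<open>ends G e\<close> is the set of the one (for a loop) or two end points of the edge \<open>e\<close>.\<close>

record ('v, 'e) multigraph =
  verts :: "'v set"
  edges :: "'e set"
  ends :: "'e \<Rightarrow> 'v set"

fun walk :: "('v, 'e) multigraph \<Rightarrow> 'v \<Rightarrow> 'e list \<Rightarrow> 'v \<Rightarrow> bool" where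
  "walk G u [] v \<longleftrightarrow> u \<in> verts G \<and> u = v"
| "walk G u (e # es) v \<longleftrightarrow>
     u \<in> verts G \<and> e \<in> edges G \<and> (\<exists>x. ends G e = {u, x} \<and> walk G x es v)"

definition connected_graph :: "('v, 'e) multigraph \<Rightarrow> bool" where
  "connected_graph G \<longleftrightarrow>
     verts G \<noteq> {} \<and> (\<forall>u\<in>verts G. \<forall>v\<in>verts G. \<exists>es. walk G u es v)"

definition induced_subgraph :: "('v, 'e) multigraph \<Rightarrow> 'v set \<Rightarrow> ('v, 'e) multigraph" where
  "induced_subgraph G C =
     \<lparr>verts = C, edges = {e \<in> edges G. ends G e \<subseteq> C}, ends = ends G\<rparr>"

definition graph_components :: "('v, 'e) multigraph \<Rightarrow> ('v, 'e) multigraph set" where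
  "graph_components G =
     (\<lambda>u. induced_subgraph G {v. \<exists>es. walk G u es v}) ` verts G"

definition graph_iso :: "('v, 'e) multigraph \<Rightarrow> ('v, 'e) multigraph \<Rightarrow> bool" where
  "graph_iso G H \<longleftrightarrow>
     (\<exists>f g. bij_betw f (verts G) (verts H) \<and> bij_betw g (edges G) (edges H) \<and>
        (\<forall>e\<in>edges G. ends H (g e) = f ` ends G e))"

definition bipartite :: "('v, 'e) multigraph \<Rightarrow> bool" where
  "bipartite G \<longleftrightarrow>
     (\<exists>A B. A \<union> B = verts G \<and> A \<inter> B = {} \<and>
        (\<forall>e\<in>edges G. \<exists>a\<in>A. \<exists>b\<in>B. ends G e = {a, b}))"

text \<open>Loops count twice.\<close>

definition degree :: "('v, 'e) multigraph \<Rightarrow> 'v \<Rightarrow> nat" where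
  "degree G v = card {e \<in> edges G. v \<in> ends G e} + card {e \<in> edges G. ends G e = {v}}"

definition graph_dist :: "('v, 'e) multigraph \<Rightarrow> 'v \<Rightarrow> 'v \<Rightarrow> enat" where
  "graph_dist G u v = (INF es \<in> {es. walk G u es v}. enat (length es))"

definition diameter :: "('v, 'e) multigraph \<Rightarrow> enat" where
  "diameter G = (SUP u \<in> verts G. SUP v \<in> verts G. graph_dist G u v)"

text \<open>A path is reduced if it never traverses an edge and immediately goes back along it;
  two parallel edges form a reduced closed path of length 2.  The girth is \<open>\<infinity>\<close> if there is no
  reduced closed path.\<close>

definition girth :: "('v, 'e) multigraph \<Rightarrow> enat" where
  "girth G =
     (INF es \<in> {es. es \<noteq> [] \<and> distinct_adj es \<and> (\<exists>u. walk G u es u)}. enat (length es))"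


section \<open>Star graphs and special presentations\<close>

definition sym_closure :: "'a presentation \<Rightarrow> 'a word set" where
  "sym_closure P =
     {u. \<exists>r\<in>set (rels P). cyclic_permutation u r \<or> cyclic_permutation u (winv r)}"

text \<open>With \<open>x = a\<close> and \<open>y = linv b\<close>, the two words in an edge are \<open>x y\<inverse> z\<close> and \<open>y x\<inverse> z\<inverse>\<close>, which
  are both in \<open>sym_closure P\<close>.  Hence the end points \<open>x\<close> and \<open>y\<close> of the edge are the first
  letters of its two words.\<close>

definition star_graph :: "'a presentation \<Rightarrow> ('a letter, 'a word set) multigraph" where
  "star_graph P =
     \<lparr>verts = gens P \<times> UNIV,
      edges = {{a # b # z, linv b # linv a # winv z} | a b z. a # b # z \<in> sym_closure P},
      ends = (\<lambda>e. hd ` e)\<rparr>"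

definition special :: "nat \<Rightarrow> nat \<Rightarrow> nat \<Rightarrow> 'a presentation \<Rightarrow> bool" where
  "special m k \<nu> P \<longleftrightarrow>
     finite (gens P) \<and>
     card (graph_components (star_graph P)) = \<nu> \<and>
     (\<forall>C\<in>graph_components (star_graph P). \<forall>D\<in>graph_components (star_graph P). graph_iso C D) \<and>
     (\<forall>C\<in>graph_components (star_graph P).
        connected_graph C \<and> bipartite C \<and> diameter C = enat m \<and> girth C = enat (2 * m) \<and>
        (\<forall>v\<in>verts C. 3 \<le> degree C v)) \<and>
     (\<forall>r\<in>set (rels P). length r = k) \<and>
     (m = 2 \<longrightarrow> 4 \<le> k)"

end

theory Submission
  imports Defs
begin

text \<open>Redundancy gives a divisor \<open>d < n\<close> of \<open>n\<close> such that \<open>\<theta>\<^sup>d(w)\<close> is a cyclic permutation of \<open>w\<close> or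
  \<open>w\<inverse>\<close>, so that the first \<open>d\<close> relators suffice.  The homomorphism to \<open>\<int>\<close> with \<open>x\<^sub>0 \<mapsto> 1\<close>,
  \<open>x\<^sub>d \<mapsto> \<mp>1\<close> and all other generators mapped to \<open>0\<close> kills every relator.  It lifts to a homomorphism,
  not factoring through \<open>\<int>\<close>, from \<open>G\<^sub>n(w)\<close> to a lamplighter group \<open>(\<int>/p) \<wr> \<int>\<close>: if \<open>n \<ge> 3\<close>, then \<open>n - 1 > d\<close> and counting shows that
  the linear system over \<open>\<int>/2\<close> for the images of the generators has a non-zero solution of finite
  support; if \<open>n = 2\<close> and \<open>w = v\<^sup>p\<close>, any finitely supported assignment modulo \<open>p\<close> works.

  A finitely presented group with such a map is large.  Wrap the line around a cycle of length \<open>k\<close>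
  so long that no relator meets both the support and the seam.  Then \<open>G\<close> acts on
  \<open>\<int>/k \<times> \<int>/p \<times> F\<^sub>2\<close>, where crossing the seam with lamp state \<open>0\<close> or \<open>1\<close> multiplies by the first or
  second generator of \<open>F\<^sub>2\<close>.  The stabiliser of a point of \<open>\<int>/k \<times> \<int>/p\<close> has finite index and maps onto \<open>F\<^sub>2\<close>.

  A special presentation has at least three generators, since a bipartite graph of girth at
  least \<open>4\<close> and minimal degree at least \<open>3\<close> has at least six vertices.\<close>

section \<open>Large quotients\<close>

text \<open>An epimorphism from \<open>K\<close> that kills \<open>N\<close> descends to the image
  of \<open>K\<close> in the quotient, which again has finite index. The basis consists of sets
  because \<open>large\<close> wants it in the element type of the quotient.\<close>

lemma large_FactGroup:
  fixes G :: "('a, 'b) monoid_scheme" and S :: "'a set set"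
  assumes N: "N \<lhd> G" and K: "subgroup K G" and NK: "N \<subseteq> K" and fin: "finite (rcosets\<^bsub>G\<^esub> K)"
    and f: "f \<in> epi (G\<lparr>carrier := K\<rparr>) (free_group S)"
    and f1: "\<And>x. x \<in> N \<Longrightarrow> f x = \<one>\<^bsub>free_group S\<^esub>"
    and ncomm: "\<not> comm_group (free_group S)"
  shows "large (G Mod N)"
proof -
  interpret N: normal N G by (rule N)
  interpret F: group "free_group S" by (rule group_free_group)
  define q where "q = (\<lambda>x. N #>\<^bsub>G\<^esub> x)"
  interpret q: group_hom G "G Mod N" q
    unfolding q_def using N.r_coset_hom_Mod N.factorgroup_is_group
    by (simp add: group_hom_def group_hom_axioms_def N.is_group)
  have KG: "K \<subseteq> carrier G" using K by (rule subgroup.subset)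
  have Kmult: "x \<otimes>\<^bsub>G\<^esub> y \<in> K" if "x \<in> K" "y \<in> K" for x y
    using K that by (rule subgroup.m_closed)
  have fhom: "f (x \<otimes>\<^bsub>G\<^esub> y) = f x \<otimes>\<^bsub>free_group S\<^esub> f y" if "x \<in> K" "y \<in> K" for x y
    using f that by (auto simp: epi_def hom_def)
  have fcl: "f x \<in> carrier (free_group S)" if "x \<in> K" for x
    using f that by (auto simp: epi_def hom_def)
  have fsurj: "f ` K = carrier (free_group S)"
    using f by (auto simp: epi_def)
  have H: "subgroup (q ` K) (G Mod N)"
    by (rule q.subgroup_img_is_subgroup[OF K])
  have "rcosets\<^bsub>G Mod N\<^esub> (q ` K) \<subseteq> (\<lambda>C. q ` C) ` (rcosets\<^bsub>G\<^esub> K)"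
  proof
    fix Y assume "Y \<in> rcosets\<^bsub>G Mod N\<^esub> (q ` K)"
    then obtain x where x: "x \<in> carrier G" "Y = (q ` K) #>\<^bsub>G Mod N\<^esub> q x"
      by (auto simp: RCOSETS_def FactGroup_def q_def)
    have "Y = (\<Union>h\<in>K. {q h \<otimes>\<^bsub>G Mod N\<^esub> q x})" using x(2) by (simp add: r_coset_def)
    also have "\<dots> = (\<Union>h\<in>K. {q (h \<otimes>\<^bsub>G\<^esub> x)})"
      using x(1) KG q.hom_mult by (intro SUP_cong) (auto simp del: mult_FactGroup)
    finally have "Y = q ` (K #>\<^bsub>G\<^esub> x)" by (simp add: r_coset_def image_UN)
    then show "Y \<in> (\<lambda>C. q ` C) ` (rcosets\<^bsub>G\<^esub> K)"
      using x by (auto simp: RCOSETS_def)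
  qed
  then have finH: "finite (rcosets\<^bsub>G Mod N\<^esub> (q ` K))"
    using fin by (blast intro: finite_subset finite_imageI)
  \<comment> \<open>A preimage in \<open>K\<close> is chosen; two of them differ by an element of
    \<open>N\<close>, which \<open>f\<close> does not see.\<close>
  define g where "g = (\<lambda>Y. f (SOME x. x \<in> K \<and> q x = Y))"
  have gq: "g (q x) = f x" if x: "x \<in> K" for x
  proof -
    define y where "y = (SOME y. y \<in> K \<and> q y = q x)"
    have "y \<in> K \<and> q y = q x" unfolding y_def by (rule someI) (use x in simp)
    then have y: "y \<in> K" "q y = q x" by auto
    have "y \<in> N #>\<^bsub>G\<^esub> y" using y KG N.rcos_self[of y] N.subgroup_axioms by auto
    then obtain h where h: "h \<in> N" "y = h \<otimes>\<^bsub>G\<^esub> x" using y by (auto simp: q_def r_coset_def)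
    then have "f y = f x" using fhom[of h x] f1[of h] NK x fcl[of x] by auto
    then show ?thesis by (simp add: g_def y_def)
  qed
  have "g \<in> epi ((G Mod N)\<lparr>carrier := q ` K\<rparr>) (free_group S)"
  proof -
    have "g (q x \<otimes>\<^bsub>G Mod N\<^esub> q y) = g (q x) \<otimes>\<^bsub>free_group S\<^esub> g (q y)"
      if "x \<in> K" "y \<in> K" for x y
    proof -
      have "q x \<otimes>\<^bsub>G Mod N\<^esub> q y = q (x \<otimes>\<^bsub>G\<^esub> y)"
        using that KG q.hom_mult[of x y] by (metis subsetD)
      then show ?thesis using that Kmult gq fhom by simp
    qed
    moreover have "g ` q ` K = carrier (free_group S)"
      using fsurj gq by (simp add: image_image)
    ultimately show ?thesis by (auto simp: epi_def hom_def)
  qed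
  with H finH ncomm show ?thesis unfolding large_def by blast
qed

text \<open>A value of \<open>h\<close> determines the right coset, so there are at most as many
  cosets as values.\<close>

lemma (in group) finite_rcosetsI:
  assumes K: "subgroup K G" and fin: "finite (h ` carrier G)"
    and eq: "\<And>x y. x \<in> carrier G \<Longrightarrow> y \<in> carrier G \<Longrightarrow> h x = h y \<Longrightarrow> x \<otimes> inv y \<in> K"
  shows "finite (rcosets K)"
proof -
  define c where "c = (\<lambda>z. K #> (SOME x. x \<in> carrier G \<and> h x = z))"
  have "rcosets K \<subseteq> c ` h ` carrier G"
  proof
    fix Y assume "Y \<in> rcosets K"
    then obtain x where x: "x \<in> carrier G" "Y = K #> x" by (auto simp: RCOSETS_def)
    define y where "y = (SOME y. y \<in> carrier G \<and> h y = h x)"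
    have "y \<in> carrier G \<and> h y = h x" unfolding y_def by (rule someI) (use x in simp)
    then have y: "y \<in> carrier G" "h y = h x" by auto
    have "x \<otimes> inv y \<in> K" using eq x y by simp
    then have "K #> (x \<otimes> inv y) = K"
      using K by (metis coset_join2 subgroup.mem_carrier)
    then have "K #> x = K #> y"
      using x y K by (metis coset_mult_inv1 subgroup.subset)
    then have "Y = c (h x)" using x by (simp add: c_def y_def)
    then show "Y \<in> c ` h ` carrier G" using x by blast
  qed
  then show ?thesis using fin by (blast intro: finite_subset finite_imageI)
qed

section \<open>Free groups acting by monomial maps\<close>

lemma mult_free_group: "u \<otimes>\<^bsub>free_group X\<^esub> v = free_reduce (u @ v)"
  by (simp add: free_group_def)

lemma one_free_group: "\<one>\<^bsub>free_group X\<^esub> = []"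
  by (simp add: free_group_def)

text \<open>Reduces surjectivity onto a free group to positive letters: inverse letters are
  inverses, and a reduced word is the product of its letters.\<close>

lemma subgroup_free_groupI:
  assumes H: "subgroup H (free_group S)" and S: "\<And>x. x \<in> S \<Longrightarrow> [(x, True)] \<in> H"
  shows "H = carrier (free_group S)"
proof
  interpret F: group "free_group S" by (rule group_free_group)
  show "H \<subseteq> carrier (free_group S)" using H by (rule subgroup.subset)
  have letter: "[c] \<in> H" if c: "fst c \<in> S" for c
  proof (cases c)
    case (Pair x s)
    show ?thesis
    proof (cases s)
      case False
      have x: "[(x, True)] \<in> H" using S c Pair by simp
      have "[(x, False)] \<otimes>\<^bsub>free_group S\<^esub> [(x, True)] = \<one>\<^bsub>free_group S\<^esub>"
        by (simp add: free_group_def free_reduce_def linv_def)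
      then have "inv\<^bsub>free_group S\<^esub> [(x, True)] = [(x, False)]"
        using c Pair by (intro F.inv_equality) (auto simp: free_group_def)
      then show ?thesis using subgroup.m_inv_closed[OF H x] Pair False by simp
    qed (use S c Pair in simp)
  qed
  show "carrier (free_group S) \<subseteq> H"
  proof
    fix u assume "u \<in> carrier (free_group S)"
    then have "reduced u" "fst ` set u \<subseteq> S" by (auto simp: free_group_def)
    then show "u \<in> H"
    proof (induction u)
      case Nil
      show ?case using subgroup.one_closed[OF H] by (simp add: one_free_group)
    next
      case (Cons c u)
      then have "u \<in> H" by (auto dest: reduced_ConsD)
      then have "[c] \<otimes>\<^bsub>free_group S\<^esub> u \<in> H"
        using letter[of c] Cons.prems subgroup.m_closed[OF H] by auto
      then show ?case using Cons.prems by (simp add: mult_free_group free_reduce_reduced)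
    qed
  qed
qed

lemma not_comm_free_group:
  assumes "a \<noteq> b"
  shows "\<not> comm_group (free_group {a, b})"
proof
  assume "comm_group (free_group {a, b})"
  then interpret comm_group "free_group {a, b}" .
  have "[(a, True)] \<otimes>\<^bsub>free_group {a, b}\<^esub> [(b, True)] =
      [(b, True)] \<otimes>\<^bsub>free_group {a, b}\<^esub> [(a, True)]"
    by (rule m_comm) (auto simp: free_group_def)
  then show False
    using assms by (simp add: free_group_def free_reduce_def linv_def)
qed

text \<open>A letter \<open>c\<close> acts on \<open>\<Omega> \<times> F\<close> by \<open>(z, g) \<mapsto> (\<sigma> c z, \<gamma> c z g)\<close>, which commutes with right
  multiplication in \<open>F\<close>.\<close>

locale monomial_action = F: group F for F :: "('f, 'm) monoid_scheme" (structure) +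
  fixes \<Omega> :: "'p set" and \<sigma> :: "'x letter \<Rightarrow> 'p \<Rightarrow> 'p" and \<gamma> :: "'x letter \<Rightarrow> 'p \<Rightarrow> 'f"
  assumes \<sigma>_closed: "z \<in> \<Omega> \<Longrightarrow> \<sigma> c z \<in> \<Omega>"
    and \<gamma>_closed: "z \<in> \<Omega> \<Longrightarrow> \<gamma> c z \<in> carrier F"
    and \<sigma>_linv: "z \<in> \<Omega> \<Longrightarrow> \<sigma> (linv c) (\<sigma> c z) = z"
    and \<gamma>_linv: "z \<in> \<Omega> \<Longrightarrow> \<gamma> (linv c) (\<sigma> c z) \<otimes> \<gamma> c z = \<one>"
begin

fun path :: "'x word \<Rightarrow> 'p \<Rightarrow> 'p" where
  "path [] z = z"
| "path (c # u) z = \<sigma> c (path u z)"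

text \<open>The factor that a word puts on the left of the \<open>F\<close>-coordinate over
  \<open>z\<close>. On the stabiliser of a point it is a homomorphism.\<close>

fun cocycle :: "'x word \<Rightarrow> 'p \<Rightarrow> 'f" where
  "cocycle [] z = \<one>"
| "cocycle (c # u) z = \<gamma> c (path u z) \<otimes> cocycle u z"

lemma path_closed: "z \<in> \<Omega> \<Longrightarrow> path u z \<in> \<Omega>"
  by (induction u) (auto intro: \<sigma>_closed)

lemma cocycle_closed: "z \<in> \<Omega> \<Longrightarrow> cocycle u z \<in> carrier F"
  by (induction u) (auto intro: \<gamma>_closed path_closed)

lemma path_append: "path (u @ v) z = path u (path v z)"
  by (induction u) auto

lemma cocycle_append:
  "z \<in> \<Omega> \<Longrightarrow> cocycle (u @ v) z = cocycle u (path v z) \<otimes> cocycle v z"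
  by (induction u) (auto simp: path_append cocycle_closed \<gamma>_closed path_closed F.m_assoc)

text \<open>Inverse letters act by inverse maps, so cancellation does not change the action. Hence
  \<open>path\<close>, and likewise \<open>cocycle\<close>, descends from words to elements of the
  free group.\<close>

lemma path_cons_red: "z \<in> \<Omega> \<Longrightarrow> path (cons_red c u) z = \<sigma> c (path u z)"
  using \<sigma>_linv[of _ "linv c"] path_closed by (cases u) auto

lemma cocycle_cons_red:
  assumes z: "z \<in> \<Omega>"
  shows "cocycle (cons_red c u) z = \<gamma> c (path u z) \<otimes> cocycle u z"
proof (cases u)
  case (Cons b v)
  show ?thesis
  proof (cases "b = linv c")
    case True
    have "\<gamma> c (\<sigma> b (path v z)) \<otimes> \<gamma> b (path v z) = \<one>"
      using \<gamma>_linv[of "path v z" b] z True path_closed by simp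
    then have "\<gamma> c (\<sigma> b (path v z)) \<otimes> (\<gamma> b (path v z) \<otimes> cocycle v z) = cocycle v z"
      using z by (simp add: F.m_assoc[symmetric] \<gamma>_closed \<sigma>_closed path_closed cocycle_closed)
    then show ?thesis using Cons True by simp
  qed (use Cons in simp)
qed simp

lemma path_free_reduce: "z \<in> \<Omega> \<Longrightarrow> path (free_reduce u) z = path u z"
  by (induction u) (auto simp: free_reduce_def path_cons_red)

lemma cocycle_free_reduce: "z \<in> \<Omega> \<Longrightarrow> cocycle (free_reduce u) z = cocycle u z"
  using path_free_reduce by (induction u) (auto simp: free_reduce_def cocycle_cons_red)

lemma path_mult:
  "z \<in> \<Omega> \<Longrightarrow> path (u \<otimes>\<^bsub>free_group X\<^esub> v) z = path u (path v z)"
  by (simp add: mult_free_group path_free_reduce path_append)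

lemma cocycle_mult:
  "z \<in> \<Omega> \<Longrightarrow> cocycle (u \<otimes>\<^bsub>free_group X\<^esub> v) z = cocycle u (path v z) \<otimes> cocycle v z"
  by (simp add: mult_free_group cocycle_free_reduce cocycle_append)

lemma path_inv:
  assumes "u \<in> carrier (free_group X)" "z \<in> \<Omega>"
  shows "path (inv\<^bsub>free_group X\<^esub> u) (path u z) = z"
    and "path u (path (inv\<^bsub>free_group X\<^esub> u) z) = z"
proof -
  interpret X: group "free_group X" by (rule group_free_group)
  have "path (inv\<^bsub>free_group X\<^esub> u \<otimes>\<^bsub>free_group X\<^esub> u) z = z"
    "path (u \<otimes>\<^bsub>free_group X\<^esub> inv\<^bsub>free_group X\<^esub> u) z = z"
    using assms by (simp_all add: one_free_group)
  then show "path (inv\<^bsub>free_group X\<^esub> u) (path u z) = z"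
    "path u (path (inv\<^bsub>free_group X\<^esub> u) z) = z"
    using assms(2) by (simp_all only: path_mult)
qed

lemma cocycle_inv:
  assumes "u \<in> carrier (free_group X)" "z \<in> \<Omega>"
  shows "cocycle (inv\<^bsub>free_group X\<^esub> u) (path u z) = inv (cocycle u z)"
proof -
  interpret X: group "free_group X" by (rule group_free_group)
  have "cocycle (inv\<^bsub>free_group X\<^esub> u \<otimes>\<^bsub>free_group X\<^esub> u) z = \<one>"
    using assms by (simp add: one_free_group)
  then have "cocycle (inv\<^bsub>free_group X\<^esub> u) (path u z) \<otimes> cocycle u z = \<one>"
    using assms(2) by (simp only: cocycle_mult)
  then show ?thesis
    using assms by (intro F.inv_equality[symmetric]) (simp_all add: cocycle_closed path_closed)
qed

definition trivially_acting :: "'x word \<Rightarrow> bool" where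
  "trivially_acting u \<longleftrightarrow> (\<forall>z\<in>\<Omega>. path u z = z \<and> cocycle u z = \<one>)"

text \<open>The kernel of an action is a normal subgroup: it is closed under products and inverses
  and contains all conjugates of relators.\<close>

lemma trivially_acting_normal_closure:
  assumes R: "R \<subseteq> carrier (free_group X)" and triv: "\<And>r. r \<in> R \<Longrightarrow> trivially_acting r"
    and u: "u \<in> normal_closure (free_group X) R"
  shows "trivially_acting u"
proof -
  interpret X: group "free_group X" by (rule group_free_group)
  let ?T = "{u \<in> carrier (free_group X). trivially_acting u}"
  have conj: "g \<otimes>\<^bsub>free_group X\<^esub> r \<otimes>\<^bsub>free_group X\<^esub> inv\<^bsub>free_group X\<^esub> g \<in> ?T"
    if g: "g \<in> carrier (free_group X)" and r: "r \<in> R" for g r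
  proof -
    have "path (g \<otimes>\<^bsub>free_group X\<^esub> r \<otimes>\<^bsub>free_group X\<^esub> inv\<^bsub>free_group X\<^esub> g) z = z \<and>
        cocycle (g \<otimes>\<^bsub>free_group X\<^esub> r \<otimes>\<^bsub>free_group X\<^esub> inv\<^bsub>free_group X\<^esub> g) z = \<one>"
      if z: "z \<in> \<Omega>" for z
    proof -
      \<comment> \<open>The relator acts trivially over \<open>y\<close>, so what remains is the
        factor of \<open>g\<close> at \<open>y\<close> times its inverse.\<close>
      define y where "y = path (inv\<^bsub>free_group X\<^esub> g) z"
      have y: "y \<in> \<Omega>" "path g y = z" "path r y = y" "cocycle r y = \<one>"
        using z g r path_inv(2)[OF g z] triv[OF r] path_closed
        by (auto simp: y_def trivially_acting_def)
      then have "cocycle (inv\<^bsub>free_group X\<^esub> g) z = inv (cocycle g y)"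
        using cocycle_inv[OF g, of y] by simp
      then show ?thesis
        using y z by (simp add: path_mult cocycle_mult cocycle_closed flip: y_def)
    qed
    then show ?thesis using g r R by (auto simp: trivially_acting_def)
  qed
  have "subgroup ?T (free_group X)"
  proof (rule X.subgroupI)
    show "?T \<noteq> {}" using X.one_closed by (auto simp: trivially_acting_def one_free_group)
  next
    fix v assume v: "v \<in> ?T"
    have "path (inv\<^bsub>free_group X\<^esub> v) z = z \<and> cocycle (inv\<^bsub>free_group X\<^esub> v) z = \<one>"
      if z: "z \<in> \<Omega>" for z
      using v z path_inv(1)[of v X z] cocycle_inv[of v X z] by (auto simp: trivially_acting_def)
    then show "inv\<^bsub>free_group X\<^esub> v \<in> ?T" using v by (simp add: trivially_acting_def)
  next
    fix v v' assume "v \<in> ?T" "v' \<in> ?T"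
    then show "v \<otimes>\<^bsub>free_group X\<^esub> v' \<in> ?T"
      by (auto simp: trivially_acting_def path_mult cocycle_mult)
  qed auto
  then have "normal_closure (free_group X) R \<subseteq> ?T"
    unfolding normal_closure_def by (rule X.generate_subgroup_incl[rotated]) (use conj in blast)
  then show ?thesis using u by blast
qed

end

text \<open>The stabiliser of \<open>z0\<close> has finite index because \<Omega> is finite. On it,
  the cocycle at \<open>z0\<close> is a homomorphism to the free group of rank two, onto because of
  \<open>ua\<close> and \<open>ub\<close>, and it kills the relators.\<close>

lemma large_of_monomial_action:
  fixes \<sigma> :: "'x letter \<Rightarrow> 'p \<Rightarrow> 'p" and \<gamma> :: "'x letter \<Rightarrow> 'p \<Rightarrow> 'x word set word"
  assumes "monomial_action (free_group {a, b}) \<Omega> \<sigma> \<gamma>" and ab: "a \<noteq> b"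
    and fin: "finite \<Omega>" and z0: "z0 \<in> \<Omega>"
    and R: "R \<subseteq> carrier (free_group X)"
    and triv: "\<And>r. r \<in> R \<Longrightarrow> monomial_action.trivially_acting (free_group {a, b}) \<Omega> \<sigma> \<gamma> r"
    and ua: "fst ` set ua \<subseteq> X" "monomial_action.path \<sigma> ua z0 = z0"
      "monomial_action.cocycle (free_group {a, b}) \<sigma> \<gamma> ua z0 = [(a, True)]"
    and ub: "fst ` set ub \<subseteq> X" "monomial_action.path \<sigma> ub z0 = z0"
      "monomial_action.cocycle (free_group {a, b}) \<sigma> \<gamma> ub z0 = [(b, True)]"
  shows "large (free_group X Mod normal_closure (free_group X) R)"
proof -
  interpret monomial_action "free_group {a, b}" \<Omega> \<sigma> \<gamma> by fact
  interpret X: group "free_group X" by (rule group_free_group)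
  let ?F = "free_group {a, b}"
  let ?N = "normal_closure (free_group X) R"
  define K where "K = {u \<in> carrier (free_group X). path u z0 = z0}"
  have K: "subgroup K (free_group X)"
  proof (rule X.subgroupI)
    show "K \<noteq> {}" using X.one_closed by (auto simp: K_def one_free_group)
  next
    fix u assume "u \<in> K"
    then show "inv\<^bsub>free_group X\<^esub> u \<in> K"
      using path_inv(1)[of u X z0] z0 by (auto simp: K_def)
  qed (use z0 in \<open>auto simp: K_def path_mult\<close>)
  have N: "?N \<lhd> free_group X" by (rule X.normal_normal_closure[OF R])
  have trivN: "trivially_acting u" if "u \<in> ?N" for u
    using trivially_acting_normal_closure R triv that by blast
  have NK: "?N \<subseteq> K"
    using trivN z0 normal_imp_subgroup[OF N, THEN subgroup.subset]
    by (auto simp: K_def trivially_acting_def)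
  have "finite (rcosets\<^bsub>free_group X\<^esub> K)"
  \<comment> \<open>The right coset of \<open>u\<close> is determined by the image of
    \<open>z0\<close> under the inverse of \<open>u\<close>.\<close>
  proof (rule X.finite_rcosetsI[OF K, where h = "\<lambda>u. path (inv\<^bsub>free_group X\<^esub> u) z0"])
    show "finite ((\<lambda>u. path (inv\<^bsub>free_group X\<^esub> u) z0) ` carrier (free_group X))"
      by (rule finite_subset[OF _ fin]) (use path_closed z0 in blast)
  next
    fix u v assume "u \<in> carrier (free_group X)" "v \<in> carrier (free_group X)"
      and "path (inv\<^bsub>free_group X\<^esub> u) z0 = path (inv\<^bsub>free_group X\<^esub> v) z0"
    then show "u \<otimes>\<^bsub>free_group X\<^esub> inv\<^bsub>free_group X\<^esub> v \<in> K"
      using path_inv(2)[of u X z0] z0 by (auto simp: K_def path_mult)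
  qed
  moreover have "(\<lambda>u. cocycle u z0) \<in> epi (free_group X\<lparr>carrier := K\<rparr>) ?F"
  proof -
    interpret K: group "free_group X\<lparr>carrier := K\<rparr>"
      using K X.subgroup_imp_group by blast
    have hom: "(\<lambda>u. cocycle u z0) \<in> hom (free_group X\<lparr>carrier := K\<rparr>) ?F"
      using z0 by (auto simp: hom_def K_def cocycle_closed cocycle_mult)
    then interpret c: group_hom "free_group X\<lparr>carrier := K\<rparr>" ?F "\<lambda>u. cocycle u z0"
      by (simp add: group_hom_def group_hom_axioms_def K.is_group F.is_group)
    \<comment> \<open>The words \<open>ua\<close> and \<open>ub\<close> need not be reduced; their
      reductions act in the same way and lie in \<open>K\<close>.\<close>
    have mem: "cocycle u z0 \<in> (\<lambda>u. cocycle u z0) ` K"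
      if "fst ` set u \<subseteq> X" "path u z0 = z0" for u
    proof (rule image_eqI)
      show "cocycle u z0 = cocycle (free_reduce u) z0" by (simp add: cocycle_free_reduce z0)
      have "fst ` set (free_reduce u) \<subseteq> X" using that(1) set_free_reduce[of u] by blast
      then show "free_reduce u \<in> K"
        using that(2) z0 by (simp add: K_def free_group_def reduced_free_reduce path_free_reduce)
    qed
    have "(\<lambda>u. cocycle u z0) ` K = carrier ?F"
    proof (rule subgroup_free_groupI)
      show "subgroup ((\<lambda>u. cocycle u z0) ` K) ?F" using c.img_is_subgroup by simp
      show "[(x, True)] \<in> (\<lambda>u. cocycle u z0) ` K" if "x \<in> {a, b}" for x
        using that mem[OF ua(1,2)] mem[OF ub(1,2)] ua(3) ub(3) by auto
    qed
    then show ?thesis using hom by (simp add: epi_def)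
  qed
  ultimately show ?thesis
    using large_FactGroup[OF N K NK] trivN z0 not_comm_free_group[OF ab]
    by (auto simp: trivially_acting_def)
qed

section \<open>Crossed sums along words\<close>

definition letter_value :: "('x \<Rightarrow> int) \<Rightarrow> 'x letter \<Rightarrow> int" where
  "letter_value e c = (if snd c then e (fst c) else - e (fst c))"

definition exp_sum :: "('x \<Rightarrow> int) \<Rightarrow> 'x word \<Rightarrow> int" where
  "exp_sum e u = (\<Sum>c\<leftarrow>u. letter_value e c)"

text \<open>A letter \<open>(x, True)\<close> moves a point \<open>z\<close> of the line to \<open>z + e x\<close> and contributes \<open>l x z\<close>; words
  are read from right to left.  Thus \<open>u \<mapsto> (exp_sum e u, crossed_sum e l u)\<close> is a homomorphism
  to the wreath product \<open>\<int> \<wr> \<int>\<close>, with the base group viewed as functions of \<open>z\<close>.\<close>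

definition letter_crossed :: "('x \<Rightarrow> int) \<Rightarrow> ('x \<Rightarrow> int \<Rightarrow> int) \<Rightarrow> 'x letter \<Rightarrow> int \<Rightarrow> int" where
  "letter_crossed e l c z = (if snd c then l (fst c) z else - l (fst c) (z - e (fst c)))"

fun crossed_sum :: "('x \<Rightarrow> int) \<Rightarrow> ('x \<Rightarrow> int \<Rightarrow> int) \<Rightarrow> 'x word \<Rightarrow> int \<Rightarrow> int" where
  "crossed_sum e l [] z = 0"
| "crossed_sum e l (c # u) z = letter_crossed e l c (z + exp_sum e u) + crossed_sum e l u z"

lemma letter_value_linv [simp]: "letter_value e (linv c) = - letter_value e c"
  by (simp add: letter_value_def linv_def)

lemma letter_crossed_linv:
  "letter_crossed e l (linv c) z = - letter_crossed e l c (z - letter_value e c)"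
  by (simp add: letter_crossed_def letter_value_def linv_def)

lemma exp_sum_Nil [simp]: "exp_sum e [] = 0"
  by (simp add: exp_sum_def)

lemma exp_sum_Cons [simp]: "exp_sum e (c # u) = letter_value e c + exp_sum e u"
  by (simp add: exp_sum_def)

lemma exp_sum_append [simp]: "exp_sum e (u @ v) = exp_sum e u + exp_sum e v"
  by (simp add: exp_sum_def)

lemma crossed_sum_append:
  "crossed_sum e l (u @ v) z = crossed_sum e l u (z + exp_sum e v) + crossed_sum e l v z"
  by (induction u) (auto simp: algebra_simps)

lemma winv_Cons: "winv (c # u) = winv u @ [linv c]"
  by (simp add: winv_def)

lemma exp_sum_winv: "exp_sum e (winv u) = - exp_sum e u"
  by (induction u) (simp_all add: winv_Cons, simp add: winv_def)

lemma crossed_sum_winv: "crossed_sum e l (winv u) z = - crossed_sum e l u (z - exp_sum e u)"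
proof (induction u arbitrary: z)
  case (Cons c u)
  then show ?case
    by (simp add: winv_Cons crossed_sum_append letter_crossed_linv algebra_simps)
qed (simp add: winv_def)

lemma exp_sum_free_reduce: "exp_sum e (free_reduce u) = exp_sum e u"
proof -
  have "exp_sum e (cons_red c v) = letter_value e c + exp_sum e v" for c v
    by (cases v) auto
  then show ?thesis by (induction u) (auto simp: free_reduce_def)
qed

lemma crossed_sum_free_reduce: "crossed_sum e l (free_reduce u) z = crossed_sum e l u z"
proof -
  have "crossed_sum e l (cons_red c v) z = crossed_sum e l (c # v) z" for c v
    by (cases v) (auto simp: letter_crossed_linv algebra_simps)
  then show ?thesis
    using exp_sum_free_reduce[of e] by (induction u) (auto simp: free_reduce_def)
qed

lemma abs_exp_sum_le:
  assumes "\<And>x. \<bar>e x\<bar> \<le> 1"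
  shows "\<bar>exp_sum e u\<bar> \<le> int (length u)"
proof (induction u)
  case (Cons c u)
  have "\<bar>letter_value e c\<bar> \<le> 1" using assms[of "fst c"] by (simp add: letter_value_def)
  then show ?case using Cons by simp
qed simp

text \<open>Each letter moves by at most one, so a word started at \<open>z\<close> reads
  \<open>l\<close> only within its length of \<open>z\<close>.\<close>

lemma crossed_sum_eq_0:
  assumes e: "\<And>x. \<bar>e x\<bar> \<le> 1"
    and l: "\<And>x y. \<bar>y - z\<bar> \<le> int (length u) \<Longrightarrow> l x y = 0"
  shows "crossed_sum e l u z = 0"
  using l
proof (induction u)
  case (Cons c u)
  have "\<bar>exp_sum e u\<bar> \<le> int (length u)" by (rule abs_exp_sum_le[OF e])
  then have "letter_crossed e l c (z + exp_sum e u) = 0"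
    using e[of "fst c"] by (auto simp: letter_crossed_def intro!: Cons.prems)
  moreover have "crossed_sum e l u z = 0" by (rule Cons.IH) (use Cons.prems in simp)
  ultimately show ?case by simp
qed simp

lemma crossed_sum_diff:
  "crossed_sum e (\<lambda>x z. l x z - l' x z) u z = crossed_sum e l u z - crossed_sum e l' u z"
  by (induction u) (auto simp: letter_crossed_def)

lemma crossed_sum_shift:
  "crossed_sum e (\<lambda>x z. l x (z - s)) u z = crossed_sum e l u (z - s)"
  by (induction u) (auto simp: letter_crossed_def algebra_simps)

text \<open>Membership in the kernel of the homomorphism to the wreath product of the integers mod
  \<open>p\<close> with the integers that \<open>e\<close> and \<open>l\<close> define.\<close>

definition lamp_relator :: "int \<Rightarrow> ('x \<Rightarrow> int) \<Rightarrow> ('x \<Rightarrow> int \<Rightarrow> int) \<Rightarrow> 'x word \<Rightarrow> bool" where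
  "lamp_relator p e l u \<longleftrightarrow> exp_sum e u = 0 \<and> (\<forall>z. p dvd crossed_sum e l u z)"

text \<open>The two words are conjugate; in terms of crossed sums, conjugation only translates
  \<open>z\<close>.\<close>

lemma lamp_relator_swap: "lamp_relator p e l (u @ v) \<Longrightarrow> lamp_relator p e l (v @ u)"
proof -
  assume "lamp_relator p e l (u @ v)"
  then have 1: "exp_sum e u = - exp_sum e v" and
    2: "p dvd crossed_sum e l u (z + exp_sum e v) + crossed_sum e l v z" for z
    by (auto simp: lamp_relator_def crossed_sum_append)
  have "p dvd crossed_sum e l (v @ u) z" for z
    using 2[of "z + exp_sum e u"] 1 by (simp add: crossed_sum_append add.commute)
  with 1 show ?thesis by (simp add: lamp_relator_def)
qed

lemma lamp_relator_winv: "lamp_relator p e l u \<Longrightarrow> lamp_relator p e l (winv u)"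
  by (simp add: lamp_relator_def exp_sum_winv crossed_sum_winv)

section \<open>Groups mapping onto lamplighter groups\<close>

text \<open>The line is wrapped to a cycle of length \<open>k\<close> with its seam between
  \<open>k - 1\<close> and \<open>0\<close>. By \<open>inside\<close>, no single step both changes
  the lamp state and crosses the seam; inverse letters need this, since the factor picked up at the
  seam depends on the lamp state.\<close>

locale lamplighter =
  fixes e :: "'x \<Rightarrow> int" and l :: "'x \<Rightarrow> int \<Rightarrow> int" and k p :: int and a b :: 'y
  assumes k: "0 < k" and p: "2 \<le> p" and ab: "a \<noteq> b"
    and inside: "l x z \<noteq> 0 \<Longrightarrow> 0 \<le> z \<Longrightarrow> z < k \<Longrightarrow> 0 \<le> z + e x \<and> z + e x < k"
begin

abbreviation F :: "'y word monoid" where "F \<equiv> free_group {a, b}"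

definition seam :: "int \<Rightarrow> int \<Rightarrow> 'y word" where
  "seam i m = (if i = 0 then [(a, True)] else if i = 1 then [(b, True)] else \<one>\<^bsub>F\<^esub>) [^]\<^bsub>F\<^esub> m"

definition \<Omega> :: "(int \<times> int) set" where "\<Omega> = {0..<k} \<times> {0..<p}"

text \<open>An inverse letter reads \<open>l\<close> at its end point, because the positive step
  that it undoes starts there.\<close>

definition step :: "'x letter \<Rightarrow> int \<times> int \<Rightarrow> int \<times> int" where
  "step c y = (let z' = fst y + letter_value e c in
     (z' mod k, (snd y + (if snd c then l (fst c) (fst y) else - l (fst c) (z' mod k))) mod p))"

definition weight :: "'x letter \<Rightarrow> int \<times> int \<Rightarrow> 'y word" where
  "weight c y = seam (snd y) ((fst y + letter_value e c) div k)"

sublocale F: group F by (rule group_free_group)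

lemma seam_base_closed:
  "(if i = 0 then [(a, True)] else if i = (1::int) then [(b, True)] else \<one>\<^bsub>F\<^esub>) \<in> carrier F"
  by (auto simp: free_group_def)

lemma seam_closed [simp]: "seam i m \<in> carrier F"
  unfolding seam_def by (rule F.int_pow_closed[OF seam_base_closed])

lemma seam_add: "seam i m \<otimes>\<^bsub>F\<^esub> seam i m' = seam i (m + m')"
  unfolding seam_def by (rule F.int_pow_mult[OF seam_base_closed, symmetric])

lemma seam_0 [simp]: "seam i 0 = \<one>\<^bsub>F\<^esub>"
  unfolding seam_def by (rule int_pow_0)

lemma seam_1: "seam 0 1 = [(a, True)]" "seam 1 1 = [(b, True)]"
  unfolding seam_def using F.int_pow_1[OF seam_base_closed[of 0]]  F.int_pow_1[OF seam_base_closed[of 1]]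
  by simp_all

lemma carry:
  assumes "0 \<le> z" "z < k"
  shows "((z + t) mod k - t) mod k = z" "((z + t) mod k - t) div k + (z + t) div k = 0"
proof -
  have 1: "(z + t) mod k - t = z + k * (- ((z + t) div k))"
    using mult_div_mod_eq[of k "z + t"] by (simp add: algebra_simps)
  show "((z + t) mod k - t) mod k = z" unfolding 1 using assms by (simp only: mod_mult_self2) simp
  show "((z + t) mod k - t) div k + (z + t) div k = 0"
    unfolding 1 using assms k by (subst div_mult_self2) auto
qed

lemma step_weight_linv:
  assumes y: "y \<in> \<Omega>"
  shows "step (linv c) (step c y) = y \<and> weight (linv c) (step c y) \<otimes>\<^bsub>F\<^esub> weight c y = \<one>\<^bsub>F\<^esub>"
proof -
  obtain z i where zi: "y = (z, i)" "0 \<le> z" "z < k" "0 \<le> i" "i < p"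
    using y by (auto simp: \<Omega>_def)
  obtain x s where c: "c = (x, s)" by (cases c)
  define t where "t = letter_value e c"
  define z' where "z' = (z + t) mod k"
  define m where "m = (if s then l x z else - l x z')"
  have z': "(z' - t) mod k = z" "(z' - t) div k + (z + t) div k = 0" "0 \<le> z'" "z' < k"
    using carry[OF zi(2,3), of t] k by (auto simp: z'_def)
  have st: "step c y = (z', (i + m) mod p)"
    by (simp add: step_def zi c Let_def z'_def t_def m_def)
  have "step (linv c) (step c y) = (z, ((i + m) mod p - m) mod p)"
    unfolding st using z' by (simp add: step_def Let_def flip: t_def) (simp add: c linv_def m_def)
  also have "\<dots> = y" using zi by (simp add: mod_diff_left_eq)
  finally have 1: "step (linv c) (step c y) = y" .
  have w: "weight c y = seam i ((z + t) div k)"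
    "weight (linv c) (step c y) = seam ((i + m) mod p) ((z' - t) div k)"
    unfolding st by (simp_all add: weight_def zi t_def)
  have "seam ((i + m) mod p) ((z' - t) div k) \<otimes>\<^bsub>F\<^esub> seam i ((z + t) div k) = \<one>\<^bsub>F\<^esub>"
  \<comment> \<open>With the lamp state unchanged, both factors are powers of one element with
    opposite exponents. Otherwise the generators may differ, but \<open>inside\<close> makes both
    exponents zero.\<close>
  proof (cases "m = 0")
    case True
    then show ?thesis using zi z' by (simp add: seam_add)
  next
    case False
    have "(z + t) div k = 0"
    proof (cases s)
      case True
      then have "0 \<le> z + t \<and> z + t < k"
        using inside[of x z] False zi by (simp add: m_def t_def c letter_value_def)
      then show ?thesis by simp
    next
      assume s: "\<not> s"
      then have "0 \<le> z' - t \<and> z' - t < k"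
        using inside[of x z'] False z' by (simp add: m_def t_def c letter_value_def)
      then have "(z' - t) div k = 0" by simp
      then show ?thesis using z' by simp
    qed
    then show ?thesis using z' by simp
  qed
  then show ?thesis using 1 by (simp add: w)
qed

sublocale monomial_action F \<Omega> step weight
proof
  show "step c y \<in> \<Omega>" if "y \<in> \<Omega>" for c y
    using k p by (auto simp: \<Omega>_def step_def Let_def)
  show "weight c y \<in> carrier F" for c y by (simp add: weight_def)
qed (use step_weight_linv in blast)+

text \<open>Started farther from the seam than its length, the word never crosses it and acts as on
  the line.\<close>

lemma action_inside:
  assumes e: "\<And>x. \<bar>e x\<bar> \<le> 1" and i: "0 \<le> i" "i < p"
    and z: "int (length u) \<le> z" "z + int (length u) < k"
  shows "path u (z, i) = (z + exp_sum e u, (i + crossed_sum e l u z) mod p) \<and>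
    cocycle u (z, i) = \<one>\<^bsub>F\<^esub>"
  using z
proof (induction u)
  case (Cons c u)
  define z' where "z' = z + exp_sum e u"
  have "\<bar>exp_sum e u\<bar> \<le> int (length u)" "\<bar>exp_sum e (c # u)\<bar> \<le> int (length (c # u))"
    by (rule abs_exp_sum_le[OF e])+
  then have z': "0 \<le> z'" "z' < k" "0 \<le> z' + letter_value e c" "z' + letter_value e c < k"
    using Cons.prems by (auto simp: z'_def)
  have IH: "path u (z, i) = (z', (i + crossed_sum e l u z) mod p)" "cocycle u (z, i) = \<one>\<^bsub>F\<^esub>"
    using Cons by (auto simp: z'_def)
  have "step c (z', (i + crossed_sum e l u z) mod p) =
      (z' + letter_value e c, (i + crossed_sum e l u z + letter_crossed e l c z') mod p)"
    using z' by (simp add: step_def Let_def letter_crossed_def mod_add_left_eq mod_diff_left_eq)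
      (simp add: letter_value_def)
  moreover have "weight c (z', (i + crossed_sum e l u z) mod p) = \<one>\<^bsub>F\<^esub>"
    using z' by (simp add: weight_def)
  ultimately show ?case using IH by (simp add: algebra_simps z'_def)
qed (use i in auto)

text \<open>Away from the support of \<open>l\<close> the lamp state stays \<open>i\<close>, so all
  factors are powers of one element and the signed crossings add up to a quotient by
  \<open>k\<close>.\<close>

lemma action_seam:
  assumes e: "\<And>x. \<bar>e x\<bar> \<le> 1" and i: "0 \<le> i" "i < p" and z: "0 \<le> z" "z < k"
    and l0: "\<And>x y. \<bar>y - z\<bar> \<le> int (length u) \<Longrightarrow> l x (y mod k) = 0"
  shows "path u (z, i) = ((z + exp_sum e u) mod k, i) \<and>
    cocycle u (z, i) = seam i ((z + exp_sum e u) div k)"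
  using l0
proof (induction u)
  case (Cons c u)
  define z' where "z' = z + exp_sum e u"
  define t where "t = letter_value e c"
  have *: "\<bar>exp_sum e u\<bar> \<le> int (length u)" by (rule abs_exp_sum_le[OF e])
  have "\<bar>t\<bar> \<le> 1" using e[of "fst c"] by (auto simp: t_def letter_value_def)
  then have "l x (z' mod k) = 0" "l x ((z' + t) mod k) = 0" for x
    using * by (auto simp: z'_def intro!: Cons.prems)
  then have "step c (z' mod k, i) = ((z' + t) mod k, i)"
    using i by (simp add: step_def Let_def mod_add_left_eq flip: t_def)
  moreover have "path u (z, i) = (z' mod k, i) \<and> cocycle u (z, i) = seam i (z' div k)"
    unfolding z'_def by (rule Cons.IH) (use Cons.prems in simp)
  moreover have "(z' mod k + t) div k + z' div k = (z' + t) div k"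
    using k div_mult_self4[of k "z' div k" "z' mod k + t"] by (simp add: algebra_simps)
  then have "weight c (z' mod k, i) \<otimes>\<^bsub>F\<^esub> seam i (z' div k) = seam i ((z' + t) div k)"
    by (simp add: weight_def seam_add flip: t_def)
  moreover have "z' + t = z + exp_sum e (c # u)" by (simp add: z'_def t_def)
  ultimately show ?case by simp
qed (use i z in auto)

lemma path_step_in:
  assumes c: "c = (x, True)" "e x = 1" "\<And>z. l x z = 0" and i: "0 \<le> i" "i < p"
    and z: "0 \<le> z" "z + int m < k"
  shows "path (replicate m c) (z, i) = (z + int m, i) \<and> cocycle (replicate m c) (z, i) = \<one>\<^bsub>F\<^esub>"
  using z(2)
proof (induction m)
  case (Suc m)
  have "step c (z + int m, i) = (z + int (Suc m), i)" "weight c (z + int m, i) = \<one>\<^bsub>F\<^esub>"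
    using c i z Suc.prems by (simp_all add: step_def weight_def Let_def letter_value_def)
  then show ?case using Suc by simp
qed simp

lemma path_step_back:
  assumes c: "c = (x, False)" "e x = 1" "\<And>z. l x z = 0" and i: "0 \<le> i" "i < p"
    and z: "z < k" "int m \<le> z"
  shows "path (replicate m c) (z, i) = (z - int m, i) \<and> cocycle (replicate m c) (z, i) = \<one>\<^bsub>F\<^esub>"
  using z(2)
proof (induction m)
  case (Suc m)
  have "step c (z - int m, i) = (z - int (Suc m), i)" "weight c (z - int m, i) = \<one>\<^bsub>F\<^esub>"
    using c i z Suc.prems by (simp_all add: step_def weight_def Let_def letter_value_def)
  then show ?case using Suc by simp
qed simp

end

text \<open>The generator \<open>t\<close> moves along the cycle without touching lamps, and
  \<open>y\<close> at position \<open>s\<close> raises the lamp state by one. Going round once in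
  state 0 yields \<open>a\<close>; doing so in state 1, between a switch and its inverse, yields
  \<open>b\<close>.\<close>

theorem large_of_lamp_relators:
  fixes e :: "'x \<Rightarrow> int" and l :: "'x \<Rightarrow> int \<Rightarrow> int"
  assumes R: "finite R" "R \<subseteq> carrier (free_group X)"
    and rel: "\<And>r. r \<in> R \<Longrightarrow> lamp_relator p e l r"
    and e: "\<And>x. \<bar>e x\<bar> \<le> 1" and p: "2 \<le> p"
    and supp: "\<And>x z. l x z \<noteq> 0 \<Longrightarrow> 0 \<le> z \<and> z < K"
    and t: "t \<in> X" "e t = 1" "\<And>z. l t z = 0"
    and y: "y \<in> X" "l y s = 1"
  shows "large (free_group X Mod normal_closure (free_group X) R)"
proof -
  obtain N where N: "\<And>r. r \<in> R \<Longrightarrow> length r \<le> N"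
    using finite_nat_set_iff_bounded_le[of "length ` R"] R(1) by auto
  \<comment> \<open>\<open>L\<close> bounds the relator lengths. Translating the support by
    \<open>2 * L\<close> leaves a margin of \<open>2 * L\<close> on either side of the seam.\<close>
  define L where "L = int N + 1"
  define k where "k = K + 4 * L"
  define l' where "l' = (\<lambda>x z. l x (z - 2 * L))"
  have s: "0 \<le> s" "s < K" using supp[of y s] y by auto
  have L: "1 \<le> L" "\<And>r. r \<in> R \<Longrightarrow> int (length r) \<le> L" using N by (force simp: L_def)+
  have supp': "2 * L \<le> z \<and> z < K + 2 * L" if "l' x z \<noteq> 0" for x z
    using supp[of x "z - 2 * L"] that by (auto simp: l'_def)
  \<comment> \<open>Any two distinct elements of the type of cosets serve as the basis.\<close>
  define a b where "a = ({} :: 'x word set)" and "b = (UNIV :: 'x word set)"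
  interpret lamplighter e l' k p a b
  proof
    fix x z assume "l' x z \<noteq> 0"
    then show "0 \<le> z + e x \<and> z + e x < k"
      using supp'[of x z] e[of x] L(1) by (auto simp: k_def)
  qed (use s L(1) p in \<open>auto simp: k_def a_def b_def\<close>)
  have X: "group (free_group X)" by (rule group_free_group)
  have lt: "l' t z = 0" for z using t by (simp add: l'_def)
  define c where "c = (t, True)"
  define m where "m = nat k"
  have loop: "path (replicate m c) (0, i) = (0, i) \<and> cocycle (replicate m c) (0, i) = seam i 1"
    if i: "0 \<le> i" "i < p" for i
  proof -
    have m: "m = Suc (m - 1)" "int (m - 1) = k - 1" using k by (auto simp: m_def)
    have "path (replicate (m - 1) c) (0, i) = (k - 1, i) \<and> cocycle (replicate (m - 1) c) (0, i) = \<one>\<^bsub>F\<^esub>"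
      using path_step_in[of c t i 0 "m - 1"] m i t lt by (simp add: c_def)
    moreover have "step c (k - 1, i) = (0, i)" "weight c (k - 1, i) = seam i 1"
      using i t k lt by (simp_all add: c_def step_def weight_def letter_value_def Let_def)
    moreover have "replicate m c = c # replicate (m - 1) c" by (subst m(1)) simp
    ultimately show ?thesis by simp
  qed
  define h where "h = s + 2 * L"
  have ly: "l' y h = 1" using y by (simp add: l'_def h_def)
  have h: "0 \<le> h" "h < k" "0 \<le> h + e y" "h + e y < k"
    using s L(1) e[of y] by (auto simp: h_def k_def)
  \<comment> \<open>Read from the right: walk to the lamp position \<open>h\<close>, switch with
    \<open>y\<close>, and walk back to \<open>0\<close>.\<close>
  define u where "u = replicate (nat (h + e y)) (t, False) @ (y, True) # replicate (nat h) c"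
  have u: "path u (0, 0) = (0, 1) \<and> cocycle u (0, 0) = \<one>\<^bsub>F\<^esub>"
  proof -
    have "path (replicate (nat h) c) (0, 0) = (h, 0) \<and> cocycle (replicate (nat h) c) (0, 0) = \<one>\<^bsub>F\<^esub>"
      using path_step_in[of c t 0 0 "nat h"] h p t lt by (simp add: c_def)
    moreover have "step (y, True) (h, 0) = (h + e y, 1)" "weight (y, True) (h, 0) = \<one>\<^bsub>F\<^esub>"
      using h p ly by (simp_all add: step_def weight_def letter_value_def Let_def)
    moreover have "path (replicate (nat (h + e y)) (t, False)) (h + e y, 1) = (0, 1) \<and>
        cocycle (replicate (nat (h + e y)) (t, False)) (h + e y, 1) = \<one>\<^bsub>F\<^esub>"
      using path_step_back[of "(t, False)" t 1 "h + e y" "nat (h + e y)"] h p t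
      lt by simp
    ultimately show ?thesis
      unfolding u_def using h k p by (subst cocycle_append) (auto simp: path_append \<Omega>_def)
  qed
  define v where "v = free_reduce u"
  have \<Omega>: "(0, 0) \<in> \<Omega>" "(0, 1) \<in> \<Omega>" using k p by (auto simp: \<Omega>_def)
  have setu: "fst ` set u \<subseteq> X" using t y by (auto simp: u_def c_def)
  have v: "v \<in> carrier (free_group X)"
    using setu set_free_reduce[of u] by (auto simp: v_def free_group_def reduced_free_reduce)
  have pv: "path v (0, 0) = (0, 1)" "cocycle v (0, 0) = \<one>\<^bsub>F\<^esub>"
    using u \<Omega> by (auto simp: v_def path_free_reduce cocycle_free_reduce)
  \<comment> \<open>The inverse of \<open>v\<close> resets the state from 1 to 0, which closes the
    loop that crosses the seam in state 1.\<close>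
  define v' where "v' = inv\<^bsub>free_group X\<^esub> v"
  have v': "v' \<in> carrier (free_group X)" unfolding v'_def by (rule group.inv_closed[OF X v])
  have pv': "path v' (0, 1) = (0, 0)" "cocycle v' (0, 1) = \<one>\<^bsub>F\<^esub>"
    using path_inv(1)[OF v \<Omega>(1)] cocycle_inv[OF v \<Omega>(1)] pv by (simp_all add: v'_def)
  show ?thesis
  proof (rule large_of_monomial_action)
    show "monomial_action F \<Omega> step weight" by unfold_locales
    show "a \<noteq> b" by (rule ab)
    show "finite \<Omega>" by (simp add: \<Omega>_def)
    show "(0, 0) \<in> \<Omega>" by fact
    show "R \<subseteq> carrier (free_group X)" by fact
    show "trivially_acting r" if r: "r \<in> R" for r
      unfolding trivially_acting_def
    proof
      fix w assume "w \<in> \<Omega>"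
      then obtain z i where w: "w = (z, i)" "0 \<le> z" "z < k" "0 \<le> i" "i < p"
        by (auto simp: \<Omega>_def)
      have r': "exp_sum e r = 0" "p dvd crossed_sum e l' r z"
        using rel[OF r] by (auto simp: lamp_relator_def l'_def crossed_sum_shift)
      show "path r w = w \<and> cocycle r w = \<one>\<^bsub>F\<^esub>"
      \<comment> \<open>Either no relator reaches the seam from \<open>z\<close>, or
        \<open>z\<close> lies within \<open>L\<close> of the seam and no relator reaches the
        support.\<close>
      proof (cases "L \<le> z \<and> z + L < k")
        case True
        obtain q where "crossed_sum e l' r z = p * q" using r'(2) by blast
        then show ?thesis
          using action_inside[OF e w(4,5), of r z] True L(2)[OF r] r'(1) w by simp
      next
        case False
        have "l' x (j mod k) = 0" if j: "\<bar>j - z\<bar> \<le> int (length r)" for x j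
        proof (rule ccontr)
          assume "l' x (j mod k) \<noteq> 0"
          then have *: "2 * L \<le> j mod k" "j mod k < K + 2 * L" using supp' by blast+
          have "\<bar>j - z\<bar> \<le> L" using j L(2)[OF r] by simp
          \<comment> \<open>The position \<open>j\<close> is not yet wrapped: the second and fourth
            cases lie beyond the seam and reduce by one period.\<close>
          then consider "0 \<le> j" "j < 2 * L" | "j < 0" "- L \<le> j" | "k - 2 * L \<le> j" "j < k"
            | "k \<le> j" "j < k + L"
            using False w by linarith
          then show False
          proof cases
            case 1 then show ?thesis using * s L by (simp add: k_def)
          next
            case 2
            then have "j mod k = j + k"
              using s L by (intro mod_pos_pos_trivial[of "j + k" k, simplified]) (auto simp: k_def)
            then show ?thesis using * 2 L by (simp add: k_def)
          next
            case 3 then show ?thesis using * s L by (simp add: k_def)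
          next
            case 4
            then have "j mod k = j - k"
              using s L mod_pos_pos_trivial[of "j - k" k] by (simp add: k_def)
            then show ?thesis using * 4 L by (simp add: k_def)
          qed
        qed
        then show ?thesis using action_seam[OF e w(4,5) w(2,3)] r'(1) w by simp
      qed
    qed
    show "fst ` set (replicate m c) \<subseteq> X" using t by (auto simp: c_def)
    show "path (replicate m c) (0, 0) = (0, 0)" "cocycle (replicate m c) (0, 0) = [(a, True)]"
      using loop[of 0] p by (simp_all add: seam_1)
    show "fst ` set (v' @ replicate m c @ v) \<subseteq> X"
      using t v v' by (auto simp: c_def free_group_def)
    show "path (v' @ replicate m c @ v) (0, 0) = (0, 0)"
      using loop[of 1] p pv pv' by (simp add: path_append)
    show "cocycle (v' @ replicate m c @ v) (0, 0) = [(b, True)]"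
      using loop[of 1] p pv pv' \<Omega> by (simp add: cocycle_append path_append seam_1(2)[symmetric])
  qed
qed

section \<open>Bipartite graphs of girth at least four\<close>

text \<open>Two edges at \<open>v\<close> with the same other end would form a reduced closed path
  of length 2. Hence the edges at \<open>v\<close>, none of which is a loop, lead to at least three
  different vertices.\<close>

lemma girth_ge_4_opposite_class:
  assumes fin: "finite B" and AB: "A \<inter> B = {}" "A \<subseteq> verts G" "B \<subseteq> verts G"
    and edges: "\<And>e. e \<in> edges G \<Longrightarrow> \<exists>a\<in>A. \<exists>b\<in>B. ends G e = {a, b}"
    and girth: "4 \<le> girth G" and v: "v \<in> A" "3 \<le> degree G v"
  shows "3 \<le> card B"
proof -
  let ?E = "{e \<in> edges G. v \<in> ends G e}"
  have "{e \<in> edges G. ends G e = {v}} = {}" using edges AB by fastforce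
  then have deg: "3 \<le> card ?E" using v(2) by (simp add: degree_def del: Collect_empty_eq)
  have other: "\<exists>b\<in>B. ends G e = {v, b}" if "e \<in> ?E" for e
    using edges[of e] that v(1) AB by auto
  have "inj_on (ends G) ?E"
  proof (rule inj_onI, rule ccontr)
    fix e f assume ef: "e \<in> ?E" "f \<in> ?E" "ends G e = ends G f" "e \<noteq> f"
    obtain b where b: "b \<in> B" "ends G e = {v, b}" using other ef(1) by blast
    have "ends G f = {b, v}" using b(2) ef(3) by (simp add: insert_commute)
    then have "walk G b [f] v" using ef(2) b(1) AB v(1) by auto
    then have "walk G v [e, f] v"
      using ef(1) b AB v(1) unfolding walk.simps(2)[of G v e] by blast
    then have "girth G \<le> enat (length [e, f])"
      unfolding girth_def using ef(4) by (intro INF_lower) auto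
    then show False using girth by (auto dest: order_trans simp: numeral_eq_enat)
  qed
  then have "card ?E = card (ends G ` ?E)" by (simp add: card_image)
  also have "\<dots> \<le> card ((\<lambda>b. {v, b}) ` B)"
    using other fin by (intro card_mono) auto
  also have "\<dots> \<le> card B" by (rule card_image_le[OF fin])
  finally show ?thesis using deg by simp
qed

text \<open>A vertex in one class forces three in the other, and these force three in the
  first.\<close>

lemma bipartite_girth_ge_4_card:
  assumes fin: "finite (verts G)" "verts G \<noteq> {}" and "bipartite G"
    and girth: "4 \<le> girth G" and deg: "\<And>v. v \<in> verts G \<Longrightarrow> 3 \<le> degree G v"
  shows "6 \<le> card (verts G)"
proof -
  obtain A B where AB: "A \<union> B = verts G" "A \<inter> B = {}"
    and edges: "\<And>e. e \<in> edges G \<Longrightarrow> \<exists>a\<in>A. \<exists>b\<in>B. ends G e = {a, b}"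
    using \<open>bipartite G\<close> by (auto simp: bipartite_def)
  have finAB: "finite A" "finite B" using AB fin(1) by (auto intro: finite_subset)
  have A: "3 \<le> card B" if "A \<noteq> {}"
    using girth_ge_4_opposite_class[OF finAB(2) AB(2) _ _ edges girth] that AB(1) deg by blast
  have edges': "\<exists>a\<in>B. \<exists>b\<in>A. ends G e = {a, b}" if "e \<in> edges G" for e
    using edges[OF that] by (metis insert_commute)
  have B: "3 \<le> card A" if "B \<noteq> {}"
    using girth_ge_4_opposite_class[OF finAB(1) _ _ _ edges' girth] that AB deg by blast
  have "A \<noteq> {} \<or> B \<noteq> {}" using AB fin(2) by auto
  then have "3 \<le> card A" "3 \<le> card B" using A B by fastforce+
  then show ?thesis using card_Un_disjoint[OF finAB AB(2)] AB(1) by simp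
qed

lemma walk_end: "walk G u es v \<Longrightarrow> v \<in> verts G"
  by (induction es arbitrary: u) auto

text \<open>One component of the star graph already has six vertices, and each generator provides
  only two.\<close>

lemma special_card_gens:
  assumes P: "special m k \<nu> P" and m: "2 \<le> m" and ne: "gens P \<noteq> {}"
  shows "3 \<le> card (gens P)"
proof -
  have fin: "finite (gens P)" using P by (simp add: special_def)
  obtain u where u: "u \<in> verts (star_graph P)" using ne by (auto simp: star_graph_def)
  define V where "V = {v. \<exists>es. walk (star_graph P) u es v}"
  define C where "C = induced_subgraph (star_graph P) V"
  have "C \<in> graph_components (star_graph P)"
    using u by (auto simp: graph_components_def C_def V_def)
  then have C: "bipartite C" "girth C = enat (2 * m)" "\<And>v. v \<in> verts C \<Longrightarrow> 3 \<le> degree C v"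
    using P by (auto simp: special_def)
  have VC: "verts C = V" by (simp add: C_def induced_subgraph_def)
  have "walk (star_graph P) u [] u" using u by simp
  then have "u \<in> V" unfolding V_def by blast
  moreover have V: "V \<subseteq> gens P \<times> UNIV"
    using walk_end by (fastforce simp: V_def star_graph_def)
  moreover have finX: "finite (gens P \<times> (UNIV :: bool set))" using fin by simp
  moreover have "(4::enat) \<le> girth C" using C(2) m by (simp add: numeral_eq_enat)
  ultimately have "6 \<le> card V"
    using bipartite_girth_ge_4_card[of C] C VC finite_subset[OF V finX] by auto
  also have "card V \<le> card (gens P \<times> (UNIV :: bool set))" using V finX by (rule card_mono[rotated])
  finally show ?thesis by (simp add: card_cartesian_product)
qed

section \<open>Cyclic permutations and shifts\<close>

lemma cyclic_permutation_iff: "cyclic_permutation u v \<longleftrightarrow> (\<exists>x y. v = x @ y \<and> u = y @ x)"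
proof
  assume "cyclic_permutation u v"
  then obtain j where "u = rotate j v" by (auto simp: cyclic_permutation_def)
  then have "v = take (j mod length v) v @ drop (j mod length v) v"
    "u = drop (j mod length v) v @ take (j mod length v) v"
    by (auto simp: rotate_drop_take)
  then show "\<exists>x y. v = x @ y \<and> u = y @ x" by blast
next
  assume "\<exists>x y. v = x @ y \<and> u = y @ x"
  then show "cyclic_permutation u v"
    unfolding cyclic_permutation_def by (metis rotate_append)
qed

lemma cyclic_permutation_trans:
  "cyclic_permutation u v \<Longrightarrow> cyclic_permutation v w \<Longrightarrow> cyclic_permutation u w"
  by (auto simp: cyclic_permutation_def rotate_rotate)

lemma winv_append: "winv (u @ v) = winv v @ winv u"
  by (simp add: winv_def)

lemma winv_winv [simp]: "winv (winv u) = u"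
  by (simp add: winv_def rev_map o_def)

lemma cyclic_permutation_winv: "cyclic_permutation u v \<Longrightarrow> cyclic_permutation (winv u) (winv v)"
  unfolding cyclic_permutation_iff by (metis winv_append)

text \<open>The sign is explicit because it is multiplicative under composition, with
  \<open>s = s'\<close> as the product, and later fixes the value of \<open>drift\<close> at
  \<open>d\<close>.\<close>

definition signed_cyclic_permutation :: "bool \<Rightarrow> 'a word \<Rightarrow> 'a word \<Rightarrow> bool" where
  "signed_cyclic_permutation s u v \<longleftrightarrow> cyclic_permutation u (if s then v else winv v)"

lemma signed_cyclic_permutation_trans:
  assumes "signed_cyclic_permutation s u v" "signed_cyclic_permutation s' v w"
  shows "signed_cyclic_permutation (s = s') u w"
proof -
  have "cyclic_permutation (if s then v else winv v) (if s = s' then w else winv w)"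
    using assms(2) cyclic_permutation_winv[of v] unfolding signed_cyclic_permutation_def
    by (cases s; cases s') force+
  then show ?thesis
    using assms(1) cyclic_permutation_trans unfolding signed_cyclic_permutation_def by blast
qed

lemma signed_cyclic_permutation_shift:
  assumes "signed_cyclic_permutation s u v"
  shows "signed_cyclic_permutation s (shift n u) (shift n v)"
proof -
  have "shift n (winv v) = winv (shift n v)"
    by (auto simp: shift_def winv_def rev_map linv_def)
  then have eq: "shift n (if s then v else winv v) = (if s then shift n v else winv (shift n v))"
    by simp
  have "cyclic_permutation (shift n u) (shift n v')" if "cyclic_permutation u v'" for v'
    using that unfolding cyclic_permutation_iff shift_def by (metis map_append)
  from this[OF assms[unfolded signed_cyclic_permutation_def]] show ?thesis
    unfolding signed_cyclic_permutation_def eq .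
qed

lemma signed_cyclic_permutation_funpow_shift:
  "signed_cyclic_permutation s u v \<Longrightarrow>
    signed_cyclic_permutation s ((shift n ^^ m) u) ((shift n ^^ m) v)"
  by (induction m) (auto intro: signed_cyclic_permutation_shift)

lemma exp_sum_signed_cyclic_permutation:
  assumes "signed_cyclic_permutation s u v"
  shows "exp_sum e u = (if s then exp_sum e v else - exp_sum e v)"
proof -
  have "exp_sum e x = exp_sum e y" if "cyclic_permutation x y" for x y
    using that by (auto simp: cyclic_permutation_iff)
  then show ?thesis
    using assms by (auto simp: signed_cyclic_permutation_def exp_sum_winv split: if_splits)
qed

lemma lamp_relator_signed_cyclic_permutation:
  assumes "signed_cyclic_permutation s u v" "lamp_relator p e l v"
  shows "lamp_relator p e l u"
proof -
  have "lamp_relator p e l x" if "cyclic_permutation x y" "lamp_relator p e l y" for x y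
    using that lamp_relator_swap by (auto simp: cyclic_permutation_iff)
  then show ?thesis
    using assms lamp_relator_winv[of p e l v] unfolding signed_cyclic_permutation_def
    by (cases s) simp_all
qed

lemma funpow_shift:
  assumes "fst ` set w \<subseteq> {..<n}"
  shows "(shift n ^^ m) w = map (\<lambda>(x, s). ((x + m) mod n, s)) w"
proof (induction m)
  case 0
  have "map (\<lambda>(x, s). (x mod n, s)) w = w"
    using assms by (intro map_idI) fastforce
  then show ?case by simp
next
  case (Suc m)
  then show ?case by (auto simp: shift_def mod_Suc_eq)
qed

lemma signed_cyclic_permutation_funpow_mult:
  assumes "signed_cyclic_permutation s ((shift n ^^ a) w) w"
  shows "\<exists>s'. signed_cyclic_permutation s' ((shift n ^^ (a * m)) w) w"
proof (induction m)
  case 0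
  have "signed_cyclic_permutation True w w"
    by (auto simp: signed_cyclic_permutation_def cyclic_permutation_iff)
  then show ?case by auto
next
  case (Suc m)
  then obtain s' where "signed_cyclic_permutation s' ((shift n ^^ (a * m)) w) w" by blast
  then have "signed_cyclic_permutation s' ((shift n ^^ a) ((shift n ^^ (a * m)) w)) ((shift n ^^ a) w)"
    by (rule signed_cyclic_permutation_funpow_shift)
  then show ?case
    using signed_cyclic_permutation_trans[OF _ assms] by (auto simp: funpow_add)
qed

text \<open>Shifts of a non-empty reduced word are not trivial, so two relators coincide up to sign
  and rotation. Their distance \<open>t\<close> is a signed period of \<open>w\<close>, and so is
  every multiple of it; modulo \<open>n\<close>, one of these is \<open>gcd t n\<close>.\<close>

lemma redundant_cyclic_presentation:
  assumes w: "w \<in> carrier (free_group {..<n})" "w \<noteq> []"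
    and red: "redundant (cyclic_presentation n w)"
  obtains d s where "0 < d" "d dvd n" "d < n" "signed_cyclic_permutation s ((shift n ^^ d) w) w"
proof -
  have gens: "fst ` set w \<subseteq> {..<n}" using w by (simp add: free_group_def)
  have cl: "(shift n ^^ i) w \<in> carrier (free_group {..<n})" for i
    by (induction i) (use w shift_closed in auto)
  have "free_reduce ((shift n ^^ i) w) \<noteq> []" for i
  proof -
    have "reduced ((shift n ^^ i) w)" using cl by (simp add: free_group_def)
    then show ?thesis using w(2) by (simp add: free_reduce_reduced funpow_shift[OF gens])
  qed
  then obtain i j s where ij: "i < n" "j < n" "i \<noteq> j"
    and s: "signed_cyclic_permutation s ((shift n ^^ i) w) ((shift n ^^ j) w)"
  proof -
    obtain i j where ij: "i < n" "j < n" "j \<noteq> i"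
      "cyclic_permutation ((shift n ^^ i) w) ((shift n ^^ j) w) \<or>
        cyclic_permutation ((shift n ^^ i) w) (winv ((shift n ^^ j) w))"
      using red \<open>\<And>i. free_reduce ((shift n ^^ i) w) \<noteq> []\<close>
      by (auto simp: redundant_def cyclic_presentation_def)
    then have "signed_cyclic_permutation True ((shift n ^^ i) w) ((shift n ^^ j) w) \<or>
        signed_cyclic_permutation False ((shift n ^^ i) w) ((shift n ^^ j) w)"
      by (simp add: signed_cyclic_permutation_def)
    then show ?thesis using that[of i j] ij(1-3) by metis
  qed
  \<comment> \<open>This is \<open>i - j\<close> modulo \<open>n\<close>, kept non-negative.\<close>
  define t where "t = i + (n - j)"
  have period: "(shift n ^^ (n * y + m)) w = (shift n ^^ m) w" for y m
  proof -
    have "(x + (n * y + m)) mod n = (x + m) mod n" for x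
      using mod_mult_self4[of n y "x + m"] by (simp add: ac_simps)
    then show ?thesis unfolding funpow_shift[OF gens] by simp
  qed
  have "signed_cyclic_permutation s ((shift n ^^ (n - j)) ((shift n ^^ i) w))
      ((shift n ^^ (n - j)) ((shift n ^^ j) w))"
    by (rule signed_cyclic_permutation_funpow_shift[OF s])
  moreover have "(shift n ^^ (n - j)) ((shift n ^^ i) w) = (shift n ^^ t) w"
    using funpow_add[of "n - j" i "shift n"] by (simp add: t_def add.commute)
  moreover have "(shift n ^^ (n - j)) ((shift n ^^ j) w) = w"
    using funpow_add[of "n - j" j "shift n"] period[of 1 0] ij by simp
  ultimately have t: "signed_cyclic_permutation s ((shift n ^^ t) w) w" by simp
  \<comment> \<open>Since \<open>t\<close> lies strictly between \<open>0\<close> and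
    \<open>2 * n\<close>, divisibility would give \<open>t = n\<close>, that is
    \<open>i = j\<close>.\<close>
  have ndvd: "\<not> n dvd t"
  proof
    assume "n dvd t"
    then obtain q where q: "i + (n - j) = n * q" by (auto simp: t_def)
    have "0 < n * q" "n * q < n * 2" unfolding q[symmetric] using ij by auto
    then have "q = 1" by simp
    then show False using q ij by simp
  qed
  obtain x y where xy: "t * x = n * y + gcd t n"
    using bezout_nat[of t n] ndvd by (cases "t = 0") auto
  obtain s' where "signed_cyclic_permutation s' ((shift n ^^ (t * x)) w) w"
    using signed_cyclic_permutation_funpow_mult[OF t] by blast
  then have "signed_cyclic_permutation s' ((shift n ^^ gcd t n) w) w"
    by (simp add: xy period)
  moreover have "0 < gcd t n" "gcd t n dvd n" using ij by auto
  moreover have "gcd t n < n"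
  proof -
    have "gcd t n \<le> n" using ij by (intro gcd_le2_nat) auto
    moreover have "gcd t n \<noteq> n" using ndvd by (metis gcd_dvd1)
    ultimately show ?thesis by simp
  qed
  ultimately show ?thesis using that by blast
qed

section \<open>Largeness of redundant cyclic presentations\<close>

text \<open>Pigeonhole: there are more subsets of \<open>Y \<times> {0..<K}\<close> than parity conditions, and the
  difference of two indicator functions satisfying the same conditions is as required.\<close>

lemma exists_even_crossed_sums:
  fixes e :: "'x \<Rightarrow> int"
  assumes e: "\<And>x. \<bar>e x\<bar> \<le> 1" and R: "finite R" and Y: "finite Y" and card: "card R < card Y"
  obtains l K y s where "\<And>x z. l x z \<noteq> 0 \<Longrightarrow> x \<in> Y \<and> 0 \<le> z \<and> z < K" "y \<in> Y" "l y s = 1"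
    "\<And>r z. r \<in> R \<Longrightarrow> 2 dvd crossed_sum e l r z"
proof -
  obtain L where L: "\<And>r. r \<in> R \<Longrightarrow> length r \<le> L"
    using finite_nat_set_iff_bounded_le[of "length ` R"] R by auto
  \<comment> \<open>The least window length for which \<open>card R * (K + 2 * L + 1)\<close>
    conditions are fewer than \<open>(card R + 1) * K\<close> unknowns.\<close>
  define K where "K = card R * (2 * L + 1) + 1"
  define J where "J = Y \<times> {0..<int K}"
  \<comment> \<open>For starting points outside this range the window is out of reach, so those
    crossed sums vanish.\<close>
  define I where "I = R \<times> {- int L..<int (K + L + 1)}"
  define ind where "ind = (\<lambda>(U :: ('x \<times> int) set) x z. of_bool ((x, z) \<in> U) :: int)"
  define par where "par = (\<lambda>U. {(r, z) \<in> I. odd (crossed_sum e (ind U) r z)})"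
  have fin: "finite I" "finite J" using R Y by (auto simp: I_def J_def)
  have "card {- int L..<int (K + L + 1)} = K + 2 * L + 1"
    unfolding card_atLeastLessThan_int by linarith
  then have "card I = card R * (K + 2 * L + 1)"
    unfolding I_def card_cartesian_product by simp
  also have "\<dots> < card R * K + K" by (simp add: K_def algebra_simps)
  also have "\<dots> \<le> card Y * K" using card mult_le_mono1[of "Suc (card R)" "card Y" K] by simp
  also have "\<dots> = card J" by (simp add: J_def card_cartesian_product)
  finally have "card (Pow I) < card (Pow J)" using fin by (simp add: card_Pow)
  moreover have "par ` Pow J \<subseteq> Pow I" by (auto simp: par_def)
  ultimately have "\<not> inj_on par (Pow J)"
    using card_inj_on_le[of par "Pow J" "Pow I"] fin by (meson finite_Pow_iff not_le)
  then obtain U V where UV: "U \<subseteq> J" "V \<subseteq> J" "U \<noteq> V" "par U = par V"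
    by (auto simp: inj_on_def)
  note witness = that
  \<comment> \<open>The larger side is named so that the difference takes the value 1, not -1, at
    the chosen point.\<close>
  have *: thesis if UV: "U \<subseteq> J" "V \<subseteq> J" "par U = par V" and ys: "(y, s) \<in> U" "(y, s) \<notin> V" for U V y s
  proof (rule witness)
    show supp: "x \<in> Y \<and> 0 \<le> z \<and> z < int K" if "ind U x z - ind V x z \<noteq> 0" for x z
    proof -
      have "(x, z) \<in> U \<union> V" using that by (auto simp: ind_def)
      then show ?thesis using UV(1,2) by (auto simp: J_def)
    qed
    show "y \<in> Y" using ys UV by (auto simp: J_def)
    show "ind U y s - ind V y s = 1" using ys by (simp add: ind_def)
    fix r z assume r: "r \<in> R"
    show "2 dvd crossed_sum e (\<lambda>x z. ind U x z - ind V x z) r z"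
    proof (cases "(r, z) \<in> I")
      case True
      have eq_in_par: "(r, z) \<in> par U \<longleftrightarrow> (r, z) \<in> par V" using UV(3) by simp
      from True have "odd (crossed_sum e (ind U) r z) \<longleftrightarrow> odd (crossed_sum e (ind V) r z)"
        using eq_in_par by (simp add: par_def)
      then show ?thesis by (simp add: crossed_sum_diff)
    next
      case False
      have "crossed_sum e (\<lambda>x z. ind U x z - ind V x z) r z = 0"
      proof (rule crossed_sum_eq_0[OF e])
        fix x z' assume "\<bar>z' - z\<bar> \<le> int (length r)"
        then have "\<not> (0 \<le> z' \<and> z' < int K)" using False L[OF r] r by (auto simp: I_def)
        then show "ind U x z' - ind V x z' = 0" using supp[of x z'] by blast
      qed
      then show ?thesis by simp
    qed
  qed
  show thesis
  proof (cases "U \<subseteq> V")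
    case True
    then obtain y s where "(y, s) \<in> V" "(y, s) \<notin> U" using UV(3) by auto
    then show ?thesis by (rule *[OF UV(2,1) UV(4)[symmetric]])
  next
    case False
    then obtain y s where "(y, s) \<in> U" "(y, s) \<notin> V" by auto
    then show ?thesis by (rule *[OF UV(1,2,4)])
  qed
qed

locale signed_periodic_word =
  fixes n d :: nat and s :: bool and w :: "nat word"
  assumes w: "w \<in> carrier (free_group {..<n})" and d: "0 < d" "d < n"
    and periodic: "signed_cyclic_permutation s ((shift n ^^ d) w) w"
begin

definition drift :: "nat \<Rightarrow> int" where
  "drift x = (if x = 0 then 1 else if x = d then (if s then -1 else 1) else 0)"

lemma shifted_period:
  "signed_cyclic_permutation s ((shift n ^^ (j + d)) w) ((shift n ^^ j) w)"
  using signed_cyclic_permutation_funpow_shift[OF periodic, of j n] by (simp add: funpow_add)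

text \<open>The exponent sum of \<open>0\<close> in a relator equals that of \<open>d\<close> in the
  relator \<open>d\<close> places later. The latter is a signed rotation of the first, so the
  exponent sums of \<open>0\<close> and \<open>d\<close> in one relator agree up to the sign
  \<open>s\<close>, and \<open>drift\<close> cancels them.\<close>

lemma exp_sum_drift: "exp_sum drift ((shift n ^^ j) w) = 0"
proof -
  let ?\<delta> = "\<lambda>i x. of_bool (x = i) :: int"
  have gens: "fst ` set w \<subseteq> {..<n}" using w by (simp add: free_group_def)
  have shift_eq: "(x + (j + d)) mod n = d \<longleftrightarrow> (x + j) mod n = 0" for x
  proof -
    have "(x + (j + d)) mod n = ((x + j) mod n + d) mod n" by (simp add: mod_add_left_eq add.assoc)
    moreover have "(m + d) mod n = d \<longleftrightarrow> m = 0" if "m < n" for m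
      using d that by (cases "m + d < n") (auto simp: mod_if)
    ultimately show ?thesis using d by simp
  qed
  have "exp_sum drift u = exp_sum (?\<delta> 0) u - (if s then 1 else -1) * exp_sum (?\<delta> d) u" for u
  proof (induction u)
    case (Cons c u)
    have "letter_value drift c = letter_value (?\<delta> 0) c - (if s then 1 else -1) * letter_value (?\<delta> d) c"
      using d by (auto simp: letter_value_def drift_def)
    with Cons show ?case by (auto simp: algebra_simps)
  qed simp
  moreover have "exp_sum (?\<delta> d) ((shift n ^^ (j + d)) w) = exp_sum (?\<delta> 0) ((shift n ^^ j) w)"
    unfolding funpow_shift[OF gens] exp_sum_def map_map
    by (rule arg_cong[where f = sum_list], rule map_cong)
      (auto simp: letter_value_def shift_eq split: prod.splits)
  moreover have "exp_sum (?\<delta> d) ((shift n ^^ (j + d)) w) =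
      (if s then 1 else -1) * exp_sum (?\<delta> d) ((shift n ^^ j) w)"
    using exp_sum_signed_cyclic_permutation[OF shifted_period[of j]] by simp
  ultimately show ?thesis by (cases s) simp_all
qed

text \<open>Only the first \<open>d\<close> relators need checking, since each later one is a signed
  rotation of the one \<open>d\<close> places before. Generator \<open>0\<close> carries no lamps
  and moves along the line.\<close>

lemma large_cyclically_presented_group:
  assumes p: "2 \<le> p" and supp: "\<And>x z. l x z \<noteq> 0 \<Longrightarrow> 0 \<le> z \<and> z < K" "\<And>z. l 0 z = 0"
    and y: "y < n" "l y q = 1"
    and crossed: "\<And>j z. j < d \<Longrightarrow> p dvd crossed_sum drift l ((shift n ^^ j) w) z"
  shows "large (cyclically_presented_group n w)"
proof -
  have rel: "lamp_relator p drift l ((shift n ^^ j) w)" for j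
  proof (induction j rule: less_induct)
    case (less j)
    show ?case
    proof (cases "j < d")
      case True
      then show ?thesis using crossed exp_sum_drift by (simp add: lamp_relator_def)
    next
      case False
      then show ?thesis
        using lamp_relator_signed_cyclic_permutation[OF shifted_period[of "j - d"]] less[of "j - d"] d
        by simp
    qed
  qed
  have cl: "(shift n ^^ i) w \<in> carrier (free_group {..<n})" for i
    by (induction i) (use w shift_closed in auto)
  have "large (free_group {..<n} Mod normal_closure (free_group {..<n})
      (set (map (\<lambda>i. (shift n ^^ i) w) [0..<n])))"
  proof (rule large_of_lamp_relators[where e = drift and l = l and t = 0])
    show "drift 0 = 1" "\<And>x. \<bar>drift x\<bar> \<le> 1" by (auto simp: drift_def)
    show "0 \<in> {..<n}" using d by simp
  qed (use rel cl p supp y in auto)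
  then show ?thesis
    by (simp add: cyclically_presented_group_def presented_group_def cyclic_presentation_def)
qed

text \<open>A proper divisor satisfies \<open>2 * d \<le> n\<close>, so for \<open>n \<ge> 3\<close>
  the \<open>n - 1\<close> generators other than \<open>0\<close> outnumber the \<open>d\<close>
  relators to be checked.\<close>

lemma large_of_three_le:
  assumes n: "3 \<le> n" "d dvd n"
  shows "large (cyclically_presented_group n w)"
proof -
  let ?R = "(\<lambda>j. (shift n ^^ j) w) ` {..<d}"
  have "2 * d \<le> n" using n d by (auto elim!: dvdE)
  then have "card ?R < card {1..<n}"
    using card_image_le[of "{..<d}" "\<lambda>j. (shift n ^^ j) w"] n by simp
  moreover have "\<bar>drift x\<bar> \<le> 1" for x by (simp add: drift_def)
  ultimately obtain l K y q where l:
    "\<And>x z. l x z \<noteq> 0 \<Longrightarrow> x \<in> {1..<n} \<and> 0 \<le> z \<and> z < K" "y \<in> {1..<n}" "l y q = 1"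
    "\<And>r z. r \<in> ?R \<Longrightarrow> 2 dvd crossed_sum drift l r z"
    using exists_even_crossed_sums[of drift ?R "{1..<n}"] by (metis finite_atLeastLessThan finite_imageI finite_lessThan)
  show ?thesis
  proof (rule large_cyclically_presented_group[of 2 l K y q])
    show "0 \<le> z \<and> z < K" if "l x z \<noteq> 0" for x z using l(1)[OF that] by simp
    show "l 0 z = 0" for z using l(1)[of 0 z] by auto
  qed (use l in auto)
qed

text \<open>Here \<open>d = 1\<close>, so \<open>w\<close> is the only relator to check. Its root
  \<open>v\<close> has \<open>drift\<close> sum zero, hence crossed sums are additive on powers of
  \<open>v\<close> and that of \<open>w\<close> is divisible by \<open>m\<close>. A single lamp on
  generator \<open>1\<close> suffices.\<close>

lemma large_of_proper_power:
  assumes "n = 2" "proper_power (free_group {..<n}) w"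
  shows "large (cyclically_presented_group n w)"
proof -
  interpret F: group "free_group {..<n}" by (rule group_free_group)
  obtain v m where v: "v \<in> carrier (free_group {..<n})" and m: "2 \<le> m"
    and wv: "w = v [^]\<^bsub>free_group {..<n}\<^esub> (m::nat)"
    using assms(2) by (auto simp: proper_power_def)
  define l where "l = (\<lambda>(x::nat) (z::int). of_bool (x = 1 \<and> z = 0) :: int)"
  have exp: "exp_sum drift (v [^]\<^bsub>free_group {..<n}\<^esub> i) = int i * exp_sum drift v" for i :: nat
    by (induction i) (simp_all add: one_free_group mult_free_group exp_sum_free_reduce algebra_simps)
  then have v0: "exp_sum drift v = 0" using exp_sum_drift[of 0] wv m by simp
  have "crossed_sum drift l (v [^]\<^bsub>free_group {..<n}\<^esub> i) z = int i * crossed_sum drift l v z" for i :: nat and z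
    by (induction i) (simp_all add: one_free_group mult_free_group crossed_sum_free_reduce
        crossed_sum_append v0 algebra_simps)
  then have "int m dvd crossed_sum drift l w z" for z by (simp add: wv)
  then have "int m dvd crossed_sum drift l ((shift n ^^ j) w) z" if "j < d" for j z
  proof -
    have "j = 0" using that d assms(1) by simp
    then show ?thesis using \<open>\<And>z. int m dvd crossed_sum drift l w z\<close> by simp
  qed
  then show ?thesis
    using m assms(1)
    by (intro large_cyclically_presented_group[of "int m" l 1 1 0]) (simp_all add: l_def)
qed

end

theorem theorem4p1:
  fixes n :: nat and w :: "nat word"
  assumes "2 \<le> n"
    and "w \<in> carrier (free_group {..<n})"
    and "w \<noteq> []"
    and "cyclically_reduced w"
    and "redundant (cyclic_presentation n w)"
  shows "(3 \<le> n \<or> (n = 2 \<and> proper_power (free_group {..<n}) w) \<longrightarrow> large (cyclically_presented_group n w)) \<and>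
    ((\<exists>m k \<nu>. 2 \<le> m \<and> 3 \<le> k \<and> 1 \<le> \<nu> \<and> special m k \<nu> (cyclic_presentation n w)) \<longrightarrow>
       large (cyclically_presented_group n w))"
proof -
  obtain d s where period: "0 < d" "d dvd n" "d < n"
    and s: "signed_cyclic_permutation s ((shift n ^^ d) w) w"
    by (rule redundant_cyclic_presentation[OF assms(2,3,5)])
  interpret signed_periodic_word n d s w
    by unfold_locales (use assms(2) period s in auto)
  have "3 \<le> n" if "special m k \<nu> (cyclic_presentation n w)" "2 \<le> m" for m k \<nu>
  proof -
    have "{..<n} \<noteq> {}" using assms(1) by (auto simp: lessThan_empty_iff)
    then show ?thesis using special_card_gens[OF that] by (simp add: cyclic_presentation_def)
  qed
  then show ?thesis using large_of_three_le[OF _ period(2)] large_of_proper_power by blast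
qed

end
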